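(* If the measured laminations $\lambda_1,\lambda_2,\dots\in\mathcal{ML}(S)$ converge in $\mathcal{ML}(S)$ to $\lambda\in\mathcal{ML}(S)$, then $\phi(\lambda_1),\phi(\lambda_2),\dots$ super converges to $\phi(\lambda)$ as subsets of $PT(S)$.
   Context: $S$ is a complete, finite-area, orientable hyperbolic surface of genus $g$ with $p$ punctures, where $3g+p\ge 5$. $\mathcal{ML}(S)$ is the space of compactly supported measured geodesic laminations on $S$ with the weak* topology, $\mathcal L(S)$ is the space of geodesic laminations, and $\phi:\mathcal{ML}(S)\to\mathcal L(S)$ is the forgetful map sending a measured lamination to its underlying geodesic lamination. $PT(S)$ is the projective unit tangent bundle of $S$; a geodesic lamination is viewed as a subset of $PT(S)$ by lifting each point to the tangent line of the leaf through it. A sequence $X_1,X_2,\dots$ of subsets of a topological space $Y$ super converges to $X\subset Y$ if for each $x\in X$ there exist $x_i\in X_i$ with $\lim_{i\to\infty}x_i=x$.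
   Formalization: Super convergence here requires x_i in X_i only for all large i, since ML(S) contains the zero lamination with empty support, for which the literal claim can fail at finitely many i; when all φ(λ_i) are nonempty this is the literal definition. *)

theory Defs
  imports "HOL-Analysis.Analysis"
begin

definition quotient_topology :: "'a topology \<Rightarrow> ('a \<Rightarrow> 'b) \<Rightarrow> 'b topology" where
  "quotient_topology X q =
     topology (\<lambda>U. U \<subseteq> q ` topspace X \<and> openin X {x \<in> topspace X. q x \<in> U})"

lemma openin_quotient_topology:
  "openin (quotient_topology X q) U \<longleftrightarrow>
     U \<subseteq> q ` topspace X \<and> openin X {x \<in> topspace X. q x \<in> U}"
proof -
  let ?P = "\<lambda>U. U \<subseteq> q ` topspace X \<and> openin X {x \<in> topspace X. q x \<in> U}"
  have "?P (S \<inter> T)" if "?P S" "?P T" for S T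
  proof -
    have "{x \<in> topspace X. q x \<in> S \<inter> T} =
        {x \<in> topspace X. q x \<in> S} \<inter> {x \<in> topspace X. q x \<in> T}" by auto
    with that show ?thesis by auto
  qed
  moreover have "?P (\<Union>K)" if "\<forall>S\<in>K. ?P S" for K
  proof -
    have "{x \<in> topspace X. q x \<in> \<Union>K} = (\<Union>S\<in>K. {x \<in> topspace X. q x \<in> S})" by auto
    moreover have "openin X (\<Union>S\<in>K. {x \<in> topspace X. q x \<in> S})"
      using that by (intro openin_Union) auto
    ultimately show ?thesis using that by auto
  qed
  ultimately have "istopology ?P" unfolding istopology_def by blast
  then show ?thesis unfolding quotient_topology_def by simp
qed

lemma topspace_quotient_topology [simp]:
  "topspace (quotient_topology X q) = q ` topspace X"
proof
  show "topspace (quotient_topology X q) \<subseteq> q ` topspace X"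
    unfolding topspace_def[of "quotient_topology X q"] by (auto simp: openin_quotient_topology)
  have "{x \<in> topspace X. q x \<in> q ` topspace X} = topspace X" by auto
  then have "openin (quotient_topology X q) (q ` topspace X)"
    by (simp add: openin_quotient_topology)
  then show "q ` topspace X \<subseteq> topspace (quotient_topology X q)"
    by (rule openin_subset)
qed

lemma quotient_map_quotient_topology: "quotient_map X (quotient_topology X q) q"
  by (auto simp: quotient_map_def openin_quotient_topology)

text \<open>
  Only the tail of the sequence of points is required to lie in the given sets, so that finitely
  many empty sets (the zero measured lamination has empty underlying lamination) are harmless.
  If no set of the sequence is empty, this is the same as asking for \<open>x i \<in> X i\<close> for every
  \<open>i\<close>; see \<open>super_converges_iff_all\<close>.
\<close>

definition super_converges :: "'a topology \<Rightarrow> (nat \<Rightarrow> 'a set) \<Rightarrow> 'a set \<Rightarrow> bool" where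
  "super_converges Y X X' \<longleftrightarrow>
     (\<forall>x\<in>X'. \<exists>xs. (\<forall>\<^sub>F i in sequentially. xs i \<in> X i) \<and> limitin Y xs x sequentially)"

lemma super_converges_iff_all:
  assumes "\<And>i. X i \<noteq> {}"
  shows "super_converges Y X X' \<longleftrightarrow>
     (\<forall>x\<in>X'. \<exists>xs. (\<forall>i. xs i \<in> X i) \<and> limitin Y xs x sequentially)"
proof
  assume L: "super_converges Y X X'"
  show "\<forall>x\<in>X'. \<exists>xs. (\<forall>i. xs i \<in> X i) \<and> limitin Y xs x sequentially"
  proof
    fix x assume "x \<in> X'"
    with L obtain xs where xs: "\<forall>\<^sub>F i in sequentially. xs i \<in> X i" "limitin Y xs x sequentially"
      unfolding super_converges_def by blast
    define ys where "ys i = (if xs i \<in> X i then xs i else (SOME y. y \<in> X i))" for i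
    have "ys i \<in> X i" for i
      using assms[of i] by (simp add: ys_def some_in_eq)
    moreover have "\<forall>\<^sub>F i in sequentially. xs i = ys i"
      using xs(1) by (rule eventually_mono) (simp add: ys_def)
    then have "limitin Y ys x sequentially"
      using xs(2) by (rule limitin_transform_eventually)
    ultimately show "\<exists>xs. (\<forall>i. xs i \<in> X i) \<and> limitin Y xs x sequentially" by blast
  qed
next
  assume R: "\<forall>x\<in>X'. \<exists>xs. (\<forall>i. xs i \<in> X i) \<and> limitin Y xs x sequentially"
  show "super_converges Y X X'"
    unfolding super_converges_def
  proof
    fix x assume "x \<in> X'"
    with R obtain xs where "\<forall>i. xs i \<in> X i" "limitin Y xs x sequentially" by blast
    then show "\<exists>xs. (\<forall>\<^sub>F i in sequentially. xs i \<in> X i) \<and> limitin Y xs x sequentially"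
      by (intro exI[of _ xs]) simp
  qed
qed

text \<open>
  The upper half-plane with the metric \<open>\<bar>dz\<bar> / Im z\<close>. Its orientation preserving isometries are
  the Moebius transformations given by real matrices of determinant 1.
\<close>

definition hplane :: "complex set" where
  "hplane = {z. Im z > 0}"

definition SL2R :: "(real^2^2) set" where
  "SL2R = {A. det A = 1}"

definition mact :: "real^2^2 \<Rightarrow> complex \<Rightarrow> complex" where
  "mact A = moebius (complex_of_real (A$1$1)) (complex_of_real (A$1$2))
                    (complex_of_real (A$2$1)) (complex_of_real (A$2$2))"

text \<open>
  For \<open>A\<close> in \<open>SL2R\<close> these are precisely the complete unit speed geodesics: the unit speed
  parametrisation \<open>t \<mapsto> \<i> e\<^sup>t\<close> of the imaginary axis and its images under isometries.
\<close>

definition geod :: "real^2^2 \<Rightarrow> real \<Rightarrow> complex" where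
  "geod A t = mact A (\<i> * complex_of_real (exp t))"

definition geod_vel :: "real^2^2 \<Rightarrow> real \<Rightarrow> complex" where
  "geod_vel A t = vector_derivative (geod A) (at t)"

text \<open>A tangent vector \<open>v\<close> at \<open>z\<close> has hyperbolic length \<open>cmod v / Im z\<close>.\<close>

definition unit_tangents :: "(complex \<times> complex) set" where
  "unit_tangents = {(z, v). z \<in> hplane \<and> cmod v = Im z}"

definition hyp_area :: "complex set \<Rightarrow> ennreal" where
  "hyp_area D = (\<integral>\<^sup>+ z. ennreal (1 / (Im z)\<^sup>2) * indicator D z \<partial>lborel)"

text \<open>
  A complete orientable hyperbolic surface is the quotient of the hyperbolic plane by a group of
  orientation preserving isometries acting freely and properly discontinuously. The group is given
  by matrices; both \<open>A\<close> and \<open>-A\<close> represent the same isometry.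
\<close>

definition surface_group :: "(real^2^2) set \<Rightarrow> bool" where
  "surface_group \<Gamma> \<longleftrightarrow>
     \<Gamma> \<subseteq> SL2R \<and> mat 1 \<in> \<Gamma> \<and>
     (\<forall>A\<in>\<Gamma>. \<forall>B\<in>\<Gamma>. A ** B \<in> \<Gamma>) \<and> (\<forall>A\<in>\<Gamma>. matrix_inv A \<in> \<Gamma>) \<and>
     (\<forall>A\<in>\<Gamma>. \<forall>z\<in>hplane. mact A z = z \<longrightarrow> A = mat 1 \<or> A = - mat 1) \<and>
     (\<forall>K. compact K \<and> K \<subseteq> hplane \<longrightarrow> finite {A \<in> \<Gamma>. mact A ` K \<inter> K \<noteq> {}})"

definition proj :: "(real^2^2) set \<Rightarrow> complex \<Rightarrow> complex set" where
  "proj \<Gamma> z = (\<lambda>A. mact A z) ` \<Gamma>"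

definition surface :: "(real^2^2) set \<Rightarrow> complex set topology" where
  "surface \<Gamma> = quotient_topology (top_of_set hplane) (proj \<Gamma>)"

definition finite_area :: "(real^2^2) set \<Rightarrow> bool" where
  "finite_area \<Gamma> \<longleftrightarrow>
     (\<exists>D. D \<in> sets borel \<and> D \<subseteq> hplane \<and> (\<forall>z\<in>hplane. \<exists>!w. w \<in> D \<inter> proj \<Gamma> z) \<and>
          hyp_area D < \<infinity>)"

definition simple_closed_curve_in :: "'a topology \<Rightarrow> 'a set \<Rightarrow> bool" where
  "simple_closed_curve_in X C \<longleftrightarrow>
     C \<subseteq> topspace X \<and> subtopology X C homeomorphic_space top_of_set (sphere (0::complex) 1)"

definition closed_surface :: "'a topology \<Rightarrow> bool" where
  "closed_surface M \<longleftrightarrow>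
     compact_space M \<and> connected_space M \<and> Hausdorff_space M \<and> topspace M \<noteq> {} \<and>
     (\<forall>x\<in>topspace M. \<exists>U. openin M U \<and> x \<in> U \<and>
        subtopology M U homeomorphic_space (euclidean :: complex topology))"

text \<open>
  The genus of an orientable surface is the largest number of pairwise disjoint simple closed
  curves whose union does not separate it.
\<close>

definition nonseparating_curves :: "'a topology \<Rightarrow> 'a set set \<Rightarrow> bool" where
  "nonseparating_curves M \<C> \<longleftrightarrow>
     finite \<C> \<and> pairwise disjnt \<C> \<and> (\<forall>C\<in>\<C>. simple_closed_curve_in M C) \<and>
     connectedin M (topspace M - \<Union>\<C>)"

definition has_genus :: "'a topology \<Rightarrow> nat \<Rightarrow> bool" where
  "has_genus M g \<longleftrightarrow>
     (\<exists>\<C>. nonseparating_curves M \<C> \<and> card \<C> = g) \<and>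
     (\<forall>\<C>. nonseparating_curves M \<C> \<longrightarrow> card \<C> \<le> g)"

text \<open>
  Genus \<open>g\<close> with \<open>p\<close> punctures: homeomorphic to a closed surface of genus \<open>g\<close> minus \<open>p\<close> points.
  The closed surface is orientable because the complement of the points is, and the type of its
  points is no restriction because surfaces have the cardinality of the continuum.
\<close>

definition has_type :: "complex set topology \<Rightarrow> nat \<Rightarrow> nat \<Rightarrow> bool" where
  "has_type X g p \<longleftrightarrow>
     (\<exists>(M :: complex set topology) P.
        closed_surface M \<and> has_genus M g \<and>
        P \<subseteq> topspace M \<and> finite P \<and> card P = p \<and>
        X homeomorphic_space subtopology M (topspace M - P))"

definition hyperbolic_surface :: "(real^2^2) set \<Rightarrow> nat \<Rightarrow> nat \<Rightarrow> bool" where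
  "hyperbolic_surface \<Gamma> g p \<longleftrightarrow>
     surface_group \<Gamma> \<and> finite_area \<Gamma> \<and> has_type (surface \<Gamma>) g p"

text \<open>A point of the bundle is the class of a unit tangent vector up to sign and up to \<open>\<Gamma>\<close>.\<close>

definition tangent_line :: "(real^2^2) set \<Rightarrow> complex \<times> complex \<Rightarrow> (complex \<times> complex) set" where
  "tangent_line \<Gamma> = (\<lambda>(z, v).
     {(mact A z, s * (deriv (mact A) z * v)) | A s. A \<in> \<Gamma> \<and> s \<in> {1, -1}})"

definition PT :: "(real^2^2) set \<Rightarrow> (complex \<times> complex) set topology" where
  "PT \<Gamma> = quotient_topology (top_of_set unit_tangents) (tangent_line \<Gamma>)"

text \<open>A lamination is given as the set of its leaves, each leaf being a subset of the surface.\<close>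

type_synonym lamination = "complex set set set"

definition geod_image :: "(real^2^2) set \<Rightarrow> real^2^2 \<Rightarrow> complex set set" where
  "geod_image \<Gamma> A = range (\<lambda>t. proj \<Gamma> (geod A t))"

text \<open>Simple: injective, or periodic and injective modulo the period.\<close>

definition simple_geod :: "(real^2^2) set \<Rightarrow> real^2^2 \<Rightarrow> bool" where
  "simple_geod \<Gamma> A \<longleftrightarrow>
     (\<forall>s t. proj \<Gamma> (geod A s) = proj \<Gamma> (geod A t) \<longrightarrow>
        (\<forall>u. proj \<Gamma> (geod A (s + u)) = proj \<Gamma> (geod A (t + u))))"

definition geodesic_lamination :: "(real^2^2) set \<Rightarrow> lamination \<Rightarrow> bool" where
  "geodesic_lamination \<Gamma> L \<longleftrightarrow>
     (\<forall>l\<in>L. \<exists>A\<in>SL2R. simple_geod \<Gamma> A \<and> l = geod_image \<Gamma> A) \<and>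
     pairwise disjnt L \<and> closedin (surface \<Gamma>) (\<Union>L)"

text \<open>The unit vectors at points of the hyperbolic plane that are tangent to lifts of leaves.\<close>

definition leaf_vectors :: "(real^2^2) set \<Rightarrow> lamination \<Rightarrow> (complex \<times> complex) set" where
  "leaf_vectors \<Gamma> L =
     {(geod A t, geod_vel A t) | A t. A \<in> SL2R \<and> geod_image \<Gamma> A \<in> L}"

definition PT_lift :: "(real^2^2) set \<Rightarrow> lamination \<Rightarrow> (complex \<times> complex) set set" where
  "PT_lift \<Gamma> L = tangent_line \<Gamma> ` leaf_vectors \<Gamma> L"

text \<open>
  A transverse arc is a regular \<open>C\<^sup>1\<close> arc in the surface, nowhere tangent to a leaf. It is
  represented by a lift to the hyperbolic plane, parametrised by the unit interval, and measures
  on the arc are measures on the unit interval.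
\<close>

definition transverse_arc :: "(real^2^2) set \<Rightarrow> lamination \<Rightarrow> (real \<Rightarrow> complex) \<Rightarrow> bool" where
  "transverse_arc \<Gamma> L c \<longleftrightarrow>
     c ` {0..1} \<subseteq> hplane \<and>
     (\<exists>c'. continuous_on {0..1} c' \<and>
        (\<forall>t\<in>{0..1}. (c has_vector_derivative c' t) (at t within {0..1}) \<and> c' t \<noteq> 0 \<and>
           (\<forall>v. (c t, v) \<in> leaf_vectors \<Gamma> L \<longrightarrow> c' t / v \<notin> \<real>)))"

type_synonym transverse_family = "(real \<Rightarrow> complex) \<Rightarrow> real measure"

text \<open>
  The third conjunct says that the support of the measure of an arc is the intersection
  of the arc with the lamination. This is asked for interior points only, since the lamination may
  accumulate on an endpoint from outside the arc.
  The fourth conjunct says that the measures are compatible with passing to subarcs and with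
  reparametrisation, and depend on the arc in the surface only, not on the lift.
  The last one says that they are invariant under homotopies through transverse arcs that move every
  point of the arc inside a leaf or inside the complement of the lamination.
\<close>

definition transverse_measure ::
    "(real^2^2) set \<Rightarrow> lamination \<Rightarrow> transverse_family \<Rightarrow> bool" where
  "transverse_measure \<Gamma> L \<mu> \<longleftrightarrow>
     \<mu> \<in> extensional {c. transverse_arc \<Gamma> L c} \<and>
     (\<forall>c. transverse_arc \<Gamma> L c \<longrightarrow>
        sets (\<mu> c) = sets (restrict_space borel {0..1}) \<and> finite_measure (\<mu> c)) \<and>
     (\<forall>c. transverse_arc \<Gamma> L c \<longrightarrow>
        emeasure (\<mu> c) {t\<in>{0..1}. proj \<Gamma> (c t) \<notin> \<Union>L} = 0 \<and>
        (\<forall>t\<in>{0<..<1}. proj \<Gamma> (c t) \<in> \<Union>L \<longrightarrow>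
           (\<forall>e>0. emeasure (\<mu> c) ({t-e<..<t+e} \<inter> {0..1}) > 0))) \<and>
     (\<forall>c d h. transverse_arc \<Gamma> L c \<and> transverse_arc \<Gamma> L d \<and>
        continuous_on {0..1} h \<and> inj_on h {0..1} \<and> h ` {0..1} \<subseteq> {0..1} \<and>
        (\<forall>t\<in>{0..1}. proj \<Gamma> (d t) = proj \<Gamma> (c (h t))) \<longrightarrow>
        (\<forall>B\<in>sets borel. B \<subseteq> {0..1} \<longrightarrow> emeasure (\<mu> d) B = emeasure (\<mu> c) (h ` B))) \<and>
     (\<forall>H. continuous_on ({0..1} \<times> {0..1}) (\<lambda>(s, t). H s t) \<and>
        (\<forall>s\<in>{0..1}. transverse_arc \<Gamma> L (H s)) \<and>
        (\<forall>t\<in>{0..1}. (\<exists>l\<in>L. \<forall>s\<in>{0..1}. proj \<Gamma> (H s t) \<in> l) \<or>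
                    (\<forall>s\<in>{0..1}. proj \<Gamma> (H s t) \<notin> \<Union>L)) \<longrightarrow>
        \<mu> (H 0) = \<mu> (H (1::real)))"

text \<open>The zero element, with no leaves, is included.\<close>

definition meas_lams :: "(real^2^2) set \<Rightarrow> (lamination \<times> transverse_family) set" where
  "meas_lams \<Gamma> = {(L, \<mu>). geodesic_lamination \<Gamma> L \<and> compactin (surface \<Gamma>) (\<Union>L) \<and>
                     transverse_measure \<Gamma> L \<mu>}"

definition forget :: "lamination \<times> transverse_family \<Rightarrow> lamination" where
  "forget = fst"

text \<open>
  The weak* topology on transverse measures of the foliation of the projective unit tangent bundle
  by lifts of geodesics: a measured lamination is a transverse measure of this foliation, and
  one tests it against continuous functions of compact support on surfaces transverse to the
  foliation. Such surfaces are given by the tangent lines at interior points of a geodesic arc that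
  are not tangent to the arc; flowing along the foliation, these suffice to cover all cases.
\<close>

definition geod_arc :: "real^2^2 \<Rightarrow> real \<Rightarrow> real \<Rightarrow> real \<Rightarrow> complex" where
  "geod_arc A a b t = geod A (a + (b - a) * t)"

definition crossing_vectors :: "real^2^2 \<Rightarrow> real \<Rightarrow> real \<Rightarrow> (complex \<times> complex) set" where
  "crossing_vectors A a b =
     {(geod A r, v) | r v. a < r \<and> r < b \<and> cmod v = Im (geod A r) \<and> v / geod_vel A r \<notin> \<real>}"

text \<open>Functions of tangent lines are even functions of unit tangent vectors.\<close>

definition test_function ::
    "real^2^2 \<Rightarrow> real \<Rightarrow> real \<Rightarrow> (complex \<times> complex \<Rightarrow> real) \<Rightarrow> bool" where
  "test_function A a b f \<longleftrightarrow>
     continuous_on (crossing_vectors A a b) f \<and>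
     (\<forall>z v. f (z, - v) = f (z, v)) \<and>
     (\<exists>K. compact K \<and> K \<subseteq> crossing_vectors A a b \<and> (\<forall>x. x \<notin> K \<longrightarrow> f x = 0))"

text \<open>
  If a geodesic arc is not transverse to a lamination, it is contained in a leaf, so that no leaf
  crosses it; the integral is then 0. Otherwise the leaf vector at a point of the lamination is
  unique up to sign, so the choice made here does not matter for even functions.
\<close>

definition pairing ::
    "(real^2^2) set \<Rightarrow> real^2^2 \<Rightarrow> real \<Rightarrow> real \<Rightarrow> (complex \<times> complex \<Rightarrow> real) \<Rightarrow>
     lamination \<times> transverse_family \<Rightarrow> real" where
  "pairing \<Gamma> A a b f = (\<lambda>(L, \<mu>). let c = geod_arc A a b in
     if transverse_arc \<Gamma> L c
     then \<integral>t. (if proj \<Gamma> (c t) \<in> \<Union>L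
                then f (c t, SOME v. (c t, v) \<in> leaf_vectors \<Gamma> L) else 0) \<partial>(\<mu> c)
     else 0)"

definition weak_star_topology :: "(real^2^2) set \<Rightarrow> (lamination \<times> transverse_family) topology" where
  "weak_star_topology \<Gamma> = topology_generated_by
     {{m \<in> meas_lams \<Gamma>. pairing \<Gamma> A a b f m \<in> U} | A a b f U.
        A \<in> SL2R \<and> a < b \<and> test_function A a b f \<and> open U}"

lemma topspace_weak_star_topology [simp]: "topspace (weak_star_topology \<Gamma>) = meas_lams \<Gamma>"
proof -
  have "mat 1 \<in> SL2R" by (simp add: SL2R_def)
  moreover have "test_function (mat 1) 0 1 (\<lambda>_. 0)"
    unfolding test_function_def by (auto intro!: exI[of _ "{}"])
  ultimately have "\<exists>A a b f (U::real set). meas_lams \<Gamma> = {m \<in> meas_lams \<Gamma>. pairing \<Gamma> A a b f m \<in> U} \<and>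
      A \<in> SL2R \<and> a < b \<and> test_function A a b f \<and> open U"
    by (intro exI[of _ "mat 1"] exI[of _ 0] exI[of _ 1] exI[of _ "\<lambda>_. 0"] exI[of _ UNIV]) auto
  then have "meas_lams \<Gamma> \<subseteq> topspace (weak_star_topology \<Gamma>)"
    unfolding weak_star_topology_def topology_generated_by_topspace by (intro Union_upper) blast
  moreover have "topspace (weak_star_topology \<Gamma>) \<subseteq> meas_lams \<Gamma>"
    unfolding weak_star_topology_def topology_generated_by_topspace by blast
  ultimately show ?thesis by blast
qed

end

theory Submission
  imports Defs
begin

text \<open>
  Let \<open>x\<close> be a vector tangent to a leaf of the limit lamination. Near \<open>x\<close> the leaf directions vary
  continuously, since leaves with nearby base points but different directions would cross, so a
  short geodesic arc perpendicular to \<open>x\<close> is transverse to the limit. Test against an even bump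
  function supported near \<open>\<plusminus>x\<close>: since the transverse measure has full support, its integral against
  the limit is positive. By weak* convergence the integral against \<open>\<lambda>\<^sub>i\<close> is eventually positive as well,
  which forces \<open>\<lambda>\<^sub>i\<close> to have a leaf vector in the support of the bump function.
\<close>

subsection \<open>Isometries and geodesics\<close>

text \<open>The main obstacle: leaves are subsets of the quotient surface, whereas crossing and
  direction concern lifts. Comparing images yields a group element that depends on the parameter.
  Since \<open>\<Gamma>\<close> is countable, one element serves two parameters, and two points
  determine a hyperbolic geodesic. With disjointness and simplicity of leaves, this shows that two
  lifted leaves with a common point are one geodesic up to orientation. Directions are controlled
  only up to sign throughout, since leaves are unoriented and \<open>pairing\<close> picks leaf
  vectors by \<open>SOME\<close>. Hence the even bump functions, and the passage to
  \<open>tangent_line\<close> at the very end. The test arc is chosen for the limit lamination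
  alone. It may fail to be transverse to some \<open>lam i\<close>, but then \<open>pairing\<close>
  is 0 by definition, so positivity excludes this case too.\<close>

lemma SL2R_iff: "A \<in> SL2R \<longleftrightarrow> A$1$1 * A$2$2 - A$1$2 * A$2$1 = 1"
  by (simp add: SL2R_def det_2)

lemma SL2R_mult: "A \<in> SL2R \<Longrightarrow> B \<in> SL2R \<Longrightarrow> A ** B \<in> SL2R"
  by (simp add: SL2R_def det_mul)

lemma SL2R_matrix_inv:
  assumes "A \<in> SL2R"
  shows "matrix_inv A \<in> SL2R" "matrix_inv A ** A = mat 1" "A ** matrix_inv A = mat 1"
proof -
  have "invertible A"
    using assms by (simp add: SL2R_def invertible_det_nz)
  then show inv: "matrix_inv A ** A = mat 1" "A ** matrix_inv A = mat 1"
    using someI_ex[of "\<lambda>A'. A ** A' = mat 1 \<and> A' ** A = mat 1"]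
    unfolding invertible_def matrix_inv_def by auto
  from inv(1) have "det (matrix_inv A) * det A = 1"
    by (metis det_I det_mul)
  with assms show "matrix_inv A \<in> SL2R"
    by (simp add: SL2R_def)
qed

lemma mact_eq:
  "mact A z = (of_real (A$1$1) * z + of_real (A$1$2)) / (of_real (A$2$1) * z + of_real (A$2$2))"
  by (simp add: mact_def moebius_def)

lemma mact_denom_nonzero:
  assumes "A \<in> SL2R" "z \<in> hplane"
  shows "of_real (A$2$1) * z + of_real (A$2$2) \<noteq> 0"
proof
  assume 0: "of_real (A$2$1) * z + of_real (A$2$2) = 0"
  then have "A$2$1 * Im z = 0"
    by (auto simp: complex_eq_iff)
  then have "A$2$1 = 0"
    using assms(2) by (simp add: hplane_def)
  with 0 have "A$2$2 = 0" by simp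
  with \<open>A$2$1 = 0\<close> assms(1) show False by (simp add: SL2R_iff)
qed

lemma Im_mact:
  assumes "A \<in> SL2R" "z \<in> hplane"
  shows "Im (mact A z) = Im z / (cmod (of_real (A$2$1) * z + of_real (A$2$2)))\<^sup>2"
proof -
  let ?n = "of_real (A$1$1) * z + of_real (A$1$2)" and ?d = "of_real (A$2$1) * z + of_real (A$2$2)"
  have "Im (mact A z) = Im (?n * cnj ?d) / (cmod ?d)\<^sup>2"
    unfolding mact_eq complex_div_cnj[of ?n ?d] Im_divide_of_real of_real_power[symmetric] ..
  also have "Im (?n * cnj ?d) = (A$1$1 * A$2$2 - A$1$2 * A$2$1) * Im z"
    by (simp add: algebra_simps)
  finally show ?thesis
    using assms(1) by (simp add: SL2R_iff)
qed

lemma mact_in_hplane: "A \<in> SL2R \<Longrightarrow> z \<in> hplane \<Longrightarrow> mact A z \<in> hplane"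
  using Im_mact[of A z] mact_denom_nonzero[of A z] by (simp add: hplane_def)

lemma mact_mult:
  assumes "A \<in> SL2R" "B \<in> SL2R" "z \<in> hplane"
  shows "mact (A ** B) z = mact A (mact B z)"
proof -
  define w where "w = of_real (B$2$1) * z + of_real (B$2$2)"
  define u where "u = of_real (B$1$1) * z + of_real (B$1$2)"
  have "w \<noteq> 0" using mact_denom_nonzero[OF assms(2,3)] by (simp add: w_def)
  have "mact A (mact B z) = (of_real (A$1$1) * (u / w) + of_real (A$1$2)) / (of_real (A$2$1) * (u / w) + of_real (A$2$2))"
    by (simp add: mact_eq u_def w_def)
  also have "\<dots> = ((of_real (A$1$1) * (u / w) + of_real (A$1$2)) * w) / ((of_real (A$2$1) * (u / w) + of_real (A$2$2)) * w)"
    using \<open>w \<noteq> 0\<close> by simp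
  also have "\<dots> = (of_real (A$1$1) * u + of_real (A$1$2) * w) / (of_real (A$2$1) * u + of_real (A$2$2) * w)"
    using \<open>w \<noteq> 0\<close> by (simp add: distrib_right)
  also have "\<dots> = mact (A ** B) z"
    by (simp add: mact_eq matrix_matrix_mult_def sum_2 u_def w_def algebra_simps)
  finally show ?thesis by simp
qed

lemma mact_one: "mact (mat 1) z = z"
  by (simp add: mact_eq mat_def)

lemma mact_matrix_inv:
  assumes "A \<in> SL2R" "z \<in> hplane"
  shows "mact (matrix_inv A) (mact A z) = z" "mact A (mact (matrix_inv A) z) = z"
  using mact_mult[OF SL2R_matrix_inv(1)[OF assms(1)] assms] mact_mult[OF assms(1) SL2R_matrix_inv(1)[OF assms(1)] assms(2)]
    SL2R_matrix_inv[OF assms(1)] by (simp_all add: mact_one)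

lemma imaginary_axis_in_hplane: "\<i> * complex_of_real (exp t) \<in> hplane"
  by (simp add: hplane_def)

lemma geod_in_hplane: "A \<in> SL2R \<Longrightarrow> geod A t \<in> hplane"
  unfolding geod_def by (intro mact_in_hplane imaginary_axis_in_hplane)

lemma geod_mult: "A \<in> SL2R \<Longrightarrow> B \<in> SL2R \<Longrightarrow> geod (A ** B) t = mact A (geod B t)"
  unfolding geod_def by (intro mact_mult imaginary_axis_in_hplane)

section \<open>Velocities and reparametrisations of geodesics\<close>

lemma has_vector_derivative_geod:
  assumes "A \<in> SL2R"
  shows "(geod A has_vector_derivative
    (\<i> * of_real (exp t) / (of_real (A$2$1) * (\<i> * of_real (exp t)) + of_real (A$2$2))\<^sup>2)) (at t)"
proof -
  let ?w = "\<i> * complex_of_real (exp t)"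
  let ?d = "of_real (A$2$1) * ?w + of_real (A$2$2)"
  have nz: "?d \<noteq> 0"
    using mact_denom_nonzero[OF assms imaginary_axis_in_hplane] .
  have "complex_of_real (A$1$1) * of_real (A$2$2) - of_real (A$1$2) * of_real (A$2$1) = 1"
    using assms unfolding SL2R_iff by (metis of_real_1 of_real_diff of_real_mult)
  then have num: "of_real (A$1$1) * ?d - (of_real (A$1$1) * ?w + of_real (A$1$2)) * of_real (A$2$1) = 1"
    by (simp add: algebra_simps)
  have "((\<lambda>z. (of_real (A$1$1) * z + of_real (A$1$2)) / (of_real (A$2$1) * z + of_real (A$2$2)))
      has_field_derivative
      (of_real (A$1$1) * ?d - (of_real (A$1$1) * ?w + of_real (A$1$2)) * of_real (A$2$1)) / (?d * ?d)) (at ?w)"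
    using nz by (auto intro!: derivative_eq_intros)
  then have m: "(mact A has_field_derivative 1 / ?d\<^sup>2) (at ?w)"
    unfolding num by (simp add: mact_eq[abs_def] power2_eq_square)
  have "((\<lambda>t. \<i> * complex_of_real (exp t)) has_vector_derivative ?w) (at t)"
    by (auto intro!: derivative_eq_intros has_vector_derivative_mult_right has_vector_derivative_of_real
        simp: has_real_derivative_iff_has_vector_derivative[symmetric])
  from field_vector_diff_chain_at[OF this m] show ?thesis
    by (simp add: o_def geod_def[abs_def])
qed

lemma geod_vel_eq:
  assumes "A \<in> SL2R"
  shows "geod_vel A t = \<i> * of_real (exp t) / (of_real (A$2$1) * (\<i> * of_real (exp t)) + of_real (A$2$2))\<^sup>2"
  unfolding geod_vel_def by (intro vector_derivative_at has_vector_derivative_geod assms)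

lemma geod_has_vector_derivative: "A \<in> SL2R \<Longrightarrow> (geod A has_vector_derivative geod_vel A t) (at t)"
  using has_vector_derivative_geod[of A t] by (simp add: geod_vel_eq)

lemma continuous_on_geod: "A \<in> SL2R \<Longrightarrow> continuous_on S (geod A)"
  using geod_has_vector_derivative has_vector_derivative_continuous
  by (blast intro: continuous_at_imp_continuous_on)

lemma continuous_on_geod_vel:
  assumes "A \<in> SL2R"
  shows "continuous_on S (geod_vel A)"
  unfolding geod_vel_eq[OF assms, abs_def]
  by (intro continuous_intros) (use mact_denom_nonzero[OF assms imaginary_axis_in_hplane] in auto)

text \<open>Unit hyperbolic speed: the denominator squared in the derivative has the same modulus as
  the factor by which \<open>Im_mact\<close> scales the height.\<close>

lemma cmod_geod_vel:
  assumes "A \<in> SL2R"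
  shows "cmod (geod_vel A t) = Im (geod A t)"
  using Im_mact[OF assms imaginary_axis_in_hplane[of t]]
  by (simp add: geod_vel_eq[OF assms] geod_def norm_mult norm_divide norm_power)

lemma geod_vel_nonzero: "A \<in> SL2R \<Longrightarrow> geod_vel A t \<noteq> 0"
  using cmod_geod_vel[of A t] geod_in_hplane[of A t] by (auto simp: hplane_def)

lemma has_vector_derivative_geod_affine:
  assumes "A \<in> SL2R"
  shows "((\<lambda>t. geod A (s + k * t)) has_vector_derivative of_real k * geod_vel A (s + k * t)) (at t)"
proof -
  have "((\<lambda>t. s + k * t) has_vector_derivative k) (at t)"
    unfolding has_real_derivative_iff_has_vector_derivative[symmetric] by (auto intro!: derivative_eq_intros)
  from vector_diff_chain_at[OF this geod_has_vector_derivative[OF assms]]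
  show ?thesis by (simp add: o_def scaleR_conv_of_real)
qed

lemma geod_vel_reparam:
  assumes "A \<in> SL2R" "\<And>t. geod B t = geod A (s + k * t)"
  shows "geod_vel B t = of_real k * geod_vel A (s + k * t)"
proof -
  have "geod B = (\<lambda>t. geod A (s + k * t))"
    using assms(2) by auto
  then show ?thesis
    unfolding geod_vel_def[of B] by (simp add: vector_derivative_at has_vector_derivative_geod_affine assms(1))
qed

lemma geod_inj:
  assumes "A \<in> SL2R" "geod A s = geod A t"
  shows "s = t"
proof -
  have "\<i> * complex_of_real (exp s) = \<i> * complex_of_real (exp t)"
    using assms mact_matrix_inv(1)[OF assms(1) imaginary_axis_in_hplane] unfolding geod_def by metis
  then show ?thesis by simp
qed

lemma geod_shift:
  assumes "A \<in> SL2R"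
  obtains B where "B \<in> SL2R" "\<And>t. geod B t = geod A (s + t)"
proof
  \<comment> \<open>This diagonal matrix acts as multiplication by \<open>exp s\<close>, the
    translation by \<open>s\<close> along the imaginary axis.\<close>
  let ?T = "vector [vector [exp (s/2), 0], vector [0, exp (-s/2)]] :: real^2^2"
  have T: "?T \<in> SL2R"
    by (simp add: SL2R_iff flip: exp_add)
  show "A ** ?T \<in> SL2R"
    using SL2R_mult[OF assms T] .
  fix t
  have "geod ?T t = \<i> * complex_of_real (exp (s + t))"
  proof -
    have "exp (s/2) = exp (-s/2) * exp s" by (simp flip: exp_add)
    then have "complex_of_real (exp (s/2)) = of_real (exp (-s/2)) * of_real (exp s)"
      by (metis of_real_mult)
    then show ?thesis
      by (simp add: geod_def mact_eq exp_add field_simps del: of_real_exp)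
  qed
  then show "geod (A ** ?T) t = geod A (s + t)"
    unfolding geod_mult[OF assms T] by (simp add: geod_def)
qed

section \<open>Geodesics with two common points\<close>

lemma mact_axis_eq:
  assumes M: "M \<in> SL2R" and "mact M (\<i> * of_real E) = \<i> * of_real F" "E > 0"
  shows "M$1$2 = - (M$2$1 * E * F)" "M$1$1 * E = M$2$2 * F"
proof -
  have "of_real (M$2$1) * (\<i> * of_real E) + of_real (M$2$2) \<noteq> 0"
    using mact_denom_nonzero[OF M, of "\<i> * of_real E"] assms(3) by (simp add: hplane_def)
  then have "of_real (M$1$1) * (\<i> * of_real E) + of_real (M$1$2)
      = \<i> * of_real F * (of_real (M$2$1) * (\<i> * of_real E) + of_real (M$2$2))"
    using assms(2) by (simp add: mact_eq field_simps)
  then show "M$1$2 = - (M$2$1 * E * F)" "M$1$1 * E = M$2$2 * F"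
    by (auto simp: complex_eq_iff algebra_simps)
qed

text \<open>If both entries of the bottom row were nonzero, \<open>mact_axis_eq\<close> would give
  \<open>E1 * F1 = E2 * F2\<close> and \<open>F1 / E1 = F2 / E2\<close>, hence
  \<open>E1 = E2\<close>. The remaining diagonal and antidiagonal matrices preserve the axis,
  keeping or reversing its direction.\<close>

lemma mact_two_points_on_axis:
  assumes M: "M \<in> SL2R"
    and 1: "mact M (\<i> * of_real E1) = \<i> * of_real F1" and 2: "mact M (\<i> * of_real E2) = \<i> * of_real F2"
    and pos: "E1 > 0" "E2 > 0" "F1 > 0" "F2 > 0" and ne: "E1 \<noteq> E2"
  shows "M$2$1 = 0 \<and> M$1$2 = 0 \<or> M$2$2 = 0 \<and> M$1$1 = 0"
proof -
  note a = mact_axis_eq[OF M 1 pos(1)] and b = mact_axis_eq[OF M 2 pos(2)]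
  have False if "M$2$1 \<noteq> 0" "M$2$2 \<noteq> 0"
  proof -
    have "E1 * F1 = E2 * F2" using a b that by (auto simp: mult.assoc)
    moreover have "F1 * E2 = F2 * E1"
    proof -
      have "M$2$2 * F1 * E2 = M$2$2 * F2 * E1"
        using a b by (metis mult.assoc mult.commute)
      then show ?thesis using that by simp
    qed
    ultimately have "E1 * E1 * F1 * F2 = E2 * E2 * F1 * F2"
      by (metis mult.assoc mult.commute)
    then have "E1\<^sup>2 = E2\<^sup>2" using pos by (simp add: power2_eq_square)
    then show False using pos ne by (simp add: power2_eq_iff)
  qed
  then have "M$2$1 = 0 \<or> M$2$2 = 0" by blast
  then show ?thesis using a pos by auto
qed

lemma geod_eq_if_two_points:
  assumes A: "A \<in> SL2R" and B: "B \<in> SL2R"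
    and 1: "geod A t1 = geod B s1" and 2: "geod A t2 = geod B s2" and ne: "t1 \<noteq> t2"
  obtains s k where "k \<in> {1, -1}" "\<And>t. geod A t = geod B (s + k * t)"
proof -
  define M where "M = matrix_inv B ** A"
  note B' = SL2R_matrix_inv[OF B]
  have M: "M \<in> SL2R" unfolding M_def using SL2R_mult B' A by blast
  have BM: "mact B (mact M (\<i> * of_real (exp t))) = geod A t" for t
  proof -
    have "mact M (\<i> * of_real (exp t)) = mact (matrix_inv B) (geod A t)"
      unfolding M_def geod_def using mact_mult[OF B'(1) A imaginary_axis_in_hplane] .
    then show ?thesis by (simp add: mact_matrix_inv(2)[OF B geod_in_hplane[OF A]])
  qed
  have Mact: "mact M (\<i> * of_real (exp t)) = \<i> * of_real (exp s)" if "geod A t = geod B s" for t s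
    using that mact_mult[OF B'(1) A imaginary_axis_in_hplane[of t]] mact_matrix_inv(1)[OF B imaginary_axis_in_hplane[of s]]
    by (simp add: M_def geod_def)
  have "M$2$1 = 0 \<and> M$1$2 = 0 \<or> M$2$2 = 0 \<and> M$1$1 = 0"
    using mact_two_points_on_axis[OF M Mact[OF 1] Mact[OF 2]] ne by simp
  then show ?thesis
  proof
    assume z: "M$2$1 = 0 \<and> M$1$2 = 0"
    with M have d: "M$1$1 * M$2$2 = 1" by (simp add: SL2R_iff)
    then have nz: "M$1$1 \<noteq> 0" "M$2$2 \<noteq> 0" by auto
    \<comment> \<open>Determinant 1 makes the ratio a nonzero square, so it has a logarithm: the
      signed distance by which \<open>M\<close> translates along the axis.\<close>
    have "M$1$1 / M$2$2 = (M$1$1)\<^sup>2"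
      using d nz by (simp add: field_simps power2_eq_square)
    then have "exp (ln (M$1$1 / M$2$2)) = M$1$1 / M$2$2"
      using nz by simp
    then have "mact M (\<i> * of_real (exp t)) = \<i> * of_real (exp (ln (M$1$1 / M$2$2) + 1 * t))" for t
      using z by (simp add: mact_eq exp_add del: of_real_exp)
    then have "geod A t = geod B (ln (M$1$1 / M$2$2) + 1 * t)" for t
      using BM[of t] by (simp add: geod_def[of B])
    then show ?thesis using that[of 1] by blast
  next
    assume z: "M$2$2 = 0 \<and> M$1$1 = 0"
    with M have d: "- M$1$2 * M$2$1 = 1" by (simp add: SL2R_iff)
    then have nz: "M$1$2 \<noteq> 0" "M$2$1 \<noteq> 0" by auto
    \<comment> \<open>An antidiagonal \<open>M\<close> acts as a constant times
      \<open>1 / z\<close>, which reverses the axis; hence the slope -1 below.\<close>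
    have "- M$1$2 / M$2$1 = (M$1$2)\<^sup>2"
      using d nz by (simp add: field_simps power2_eq_square)
    then have "exp (ln (- M$1$2 / M$2$1)) = - M$1$2 / M$2$1"
      using nz by simp
    then have e: "exp (ln (- M$1$2 / M$2$1) + (-1) * t) = - M$1$2 / M$2$1 * exp (- t)" for t
      by (simp only: exp_add) simp
    have "mact M (\<i> * of_real (exp t)) = \<i> * of_real (exp (ln (- M$1$2 / M$2$1) + (-1) * t))" for t
      unfolding e using z nz by (simp add: mact_eq exp_minus field_simps del: of_real_exp)
    then have "geod A t = geod B (ln (- M$1$2 / M$2$1) + (-1) * t)" for t
      using BM[of t] by (simp add: geod_def[of B])
    then show ?thesis using that[of "-1"] by blast
  qed
qed

subsection \<open>Leaves of a lamination\<close>

lemma surface_groupD: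
  assumes "surface_group \<Gamma>"
  shows "\<And>A. A \<in> \<Gamma> \<Longrightarrow> A \<in> SL2R" "mat 1 \<in> \<Gamma>"
    "\<And>A B. A \<in> \<Gamma> \<Longrightarrow> B \<in> \<Gamma> \<Longrightarrow> A ** B \<in> \<Gamma>" "\<And>A. A \<in> \<Gamma> \<Longrightarrow> matrix_inv A \<in> \<Gamma>"
    "\<And>A z. A \<in> \<Gamma> \<Longrightarrow> z \<in> hplane \<Longrightarrow> mact A z = z \<Longrightarrow> A = mat 1 \<or> A = - mat 1"
    "\<And>K. compact K \<Longrightarrow> K \<subseteq> hplane \<Longrightarrow> finite {A \<in> \<Gamma>. mact A ` K \<inter> K \<noteq> {}}"
  using assms unfolding surface_group_def by blast+

lemma mact_uminus: "mact (- A) z = mact A z"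
proof -
  have "mact (- A) z = - (of_real (A$1$1) * z + of_real (A$1$2)) / - (of_real (A$2$1) * z + of_real (A$2$2))"
    by (simp add: mact_eq)
  then show ?thesis by (simp only: mact_eq divide_minus_left divide_minus_right minus_minus)
qed

text \<open>\<open>matrix_inv B ** A\<close> fixes \<open>z\<close>, so freeness leaves only plus or
  minus the identity, and both act trivially.\<close>

lemma mact_eq_if_eq_at:
  assumes \<Gamma>: "surface_group \<Gamma>" and "A \<in> \<Gamma>" "B \<in> \<Gamma>" "z \<in> hplane" "mact A z = mact B z" "w \<in> hplane"
  shows "mact A w = mact B w"
proof -
  note G = surface_groupD[OF \<Gamma>]
  let ?M = "matrix_inv B ** A"
  have AB: "A \<in> SL2R" "B \<in> SL2R" using assms G(1) by auto
  note B' = SL2R_matrix_inv[OF AB(2)]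
  have "mact ?M z = z"
    using mact_mult[OF B'(1) AB(1) assms(4)] assms(5) mact_matrix_inv(1)[OF AB(2) assms(4)] by simp
  moreover have "?M \<in> \<Gamma>" by (intro G(3,4) assms)
  ultimately have "?M = mat 1 \<or> ?M = - mat 1" using G(5) assms(4) by blast
  then have "mact ?M w = w" by (auto simp: mact_uminus mact_one)
  then have "mact (matrix_inv B) (mact A w) = w"
    using mact_mult[OF B'(1) AB(1) assms(6)] by simp
  then show ?thesis
    using mact_matrix_inv(2)[OF AB(2) mact_in_hplane[OF AB(1) assms(6)]] by simp
qed

lemma proj_eq_iff:
  assumes \<Gamma>: "surface_group \<Gamma>" and "z \<in> hplane" "w \<in> hplane"
  shows "proj \<Gamma> z = proj \<Gamma> w \<longleftrightarrow> (\<exists>A\<in>\<Gamma>. z = mact A w)"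
proof
  note G = surface_groupD[OF \<Gamma>]
  assume "proj \<Gamma> z = proj \<Gamma> w"
  moreover have "z \<in> proj \<Gamma> z"
    unfolding proj_def using G(2) mact_one[of z] by (metis imageI)
  ultimately show "\<exists>A\<in>\<Gamma>. z = mact A w" unfolding proj_def by auto
next
  note G = surface_groupD[OF \<Gamma>]
  have sub: "proj \<Gamma> (mact A w) \<subseteq> proj \<Gamma> w" if "A \<in> \<Gamma>" "w \<in> hplane" for A w
  proof
    fix x assume "x \<in> proj \<Gamma> (mact A w)"
    then obtain B where "B \<in> \<Gamma>" "x = mact B (mact A w)" by (auto simp: proj_def)
    then have "x = mact (B ** A) w" "B ** A \<in> \<Gamma>"
      using that by (simp_all add: mact_mult G(1,3))
    then show "x \<in> proj \<Gamma> w" by (auto simp: proj_def)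
  qed
  assume "\<exists>A\<in>\<Gamma>. z = mact A w"
  then obtain A where A: "A \<in> \<Gamma>" "z = mact A w" by blast
  have "mact (matrix_inv A) z = w" using A mact_matrix_inv(1)[OF G(1)[OF A(1)] assms(3)] by simp
  with sub[OF A(1) assms(3)] sub[OF G(4)[OF A(1)] assms(2)] A(2) show "proj \<Gamma> z = proj \<Gamma> w" by auto
qed

section \<open>From images in the surface to lifts\<close>

lemma surface_group_countable:
  assumes \<Gamma>: "surface_group \<Gamma>"
  shows "countable \<Gamma>"
proof -
  \<comment> \<open>These compact sets exhaust the half-plane. Once \<open>K n\<close> contains both
    \<i> and \<open>mact A \<i>\<close>, the element \<open>A\<close> is one of the finitely many
    allowed by proper discontinuity.\<close>
  define K where "K n = {z. Im z \<ge> 1 / real (Suc n)} \<inter> cball 0 (real n)" for n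
  have "\<i> \<in> hplane" by (simp add: hplane_def)
  have K: "compact (K n)" "K n \<subseteq> hplane" for n
  proof -
    have "closed {z. Im z \<ge> 1 / real (Suc n)}"
      by (intro closed_Collect_le continuous_intros)
    then show "compact (K n)" unfolding K_def by (simp add: closed_Int_compact)
    show "K n \<subseteq> hplane" unfolding K_def hplane_def
      using order_less_le_trans[of 0 "1 / real (Suc n)"] by auto
  qed
  have ev: "eventually (\<lambda>n. z \<in> K n) sequentially" if "z \<in> hplane" for z
  proof -
    have "(\<lambda>n. 1 / real (Suc n)) \<longlonglongrightarrow> 0"
      using LIMSEQ_inverse_real_of_nat by (simp add: inverse_eq_divide)
    then have "eventually (\<lambda>n. 1 / real (Suc n) < Im z) sequentially"
      by (rule order_tendstoD(2)) (use that in \<open>simp add: hplane_def\<close>)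
    moreover have "eventually (\<lambda>n. cmod z \<le> real n) sequentially"
      using filterlim_real_sequentially unfolding filterlim_at_top by blast
    ultimately show ?thesis by eventually_elim (auto simp: K_def)
  qed
  have "\<Gamma> \<subseteq> (\<Union>n. {A \<in> \<Gamma>. mact A ` K n \<inter> K n \<noteq> {}})"
  proof
    fix A assume A: "A \<in> \<Gamma>"
    have "mact A \<i> \<in> hplane" using surface_groupD(1)[OF \<Gamma> A] \<open>\<i> \<in> hplane\<close> by (rule mact_in_hplane)
    then have "eventually (\<lambda>n. \<i> \<in> K n \<and> mact A \<i> \<in> K n) sequentially"
      using ev[of \<i>] ev[of "mact A \<i>"] \<open>\<i> \<in> hplane\<close> by (simp add: eventually_conj)
    then obtain n where "\<i> \<in> K n" "mact A \<i> \<in> K n"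
      using eventually_happens trivial_limit_sequentially by blast
    then show "A \<in> (\<Union>n. {A \<in> \<Gamma>. mact A ` K n \<inter> K n \<noteq> {}})" using A by auto
  qed
  moreover have "countable (\<Union>n. {A \<in> \<Gamma>. mact A ` K n \<inter> K n \<noteq> {}})"
    using surface_groupD(6)[OF \<Gamma> K] by (intro countable_UN) (auto intro: countable_finite)
  ultimately show ?thesis by (rule countable_subset)
qed

text \<open>The reals are uncountable, so some element serves uncountably many parameters. Two of
  them suffice later, because two points determine a geodesic; no continuity of the choice of group
  elements is involved.\<close>

lemma two_parameters_same_element:
  fixes \<Gamma> :: "'a set" and P :: "'a \<Rightarrow> real \<Rightarrow> bool"
  assumes "countable \<Gamma>" "\<And>t. \<exists>A\<in>\<Gamma>. P A t"
  obtains A t1 t2 where "A \<in> \<Gamma>" "t1 \<noteq> t2" "P A t1" "P A t2"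
proof -
  have "\<not> (\<forall>A\<in>\<Gamma>. countable {t. P A t})"
  proof
    assume "\<forall>A\<in>\<Gamma>. countable {t. P A t}"
    then have "countable (\<Union>A\<in>\<Gamma>. {t. P A t})" using assms(1) by blast
    moreover have "(\<Union>A\<in>\<Gamma>. {t. P A t}) = UNIV" using assms(2) by auto
    ultimately show False using uncountable_UNIV_real by simp
  qed
  then obtain A where A: "A \<in> \<Gamma>" "uncountable {t. P A t}" by blast
  have "\<not> (\<forall>t1\<in>{t. P A t}. \<forall>t2\<in>{t. P A t}. t1 = t2)"
  proof
    assume "\<forall>t1\<in>{t. P A t}. \<forall>t2\<in>{t. P A t}. t1 = t2"
    then have "{t. P A t} \<subseteq> {SOME t. P A t}" by (auto intro: someI)
    then show False using A(2) by (meson countable_finite finite.emptyI finite.insertI finite_subset)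
  qed
  then show ?thesis using that A(1) by blast
qed

text \<open>
  Only countably many translates of \<open>C\<close> cover the uncountably many points of \<open>A\<close>, so some translate
  shares two points with \<open>A\<close>, and geodesics sharing two points coincide.
\<close>

lemma geod_image_subset_imp_translate:
  assumes \<Gamma>: "surface_group \<Gamma>" and A: "A \<in> SL2R" and C: "C \<in> SL2R"
    and sub: "geod_image \<Gamma> A \<subseteq> geod_image \<Gamma> C"
  obtains B s k where "B \<in> \<Gamma>" "k \<in> {1, -1}" "\<And>t. geod A t = mact B (geod C (s + k * t))"
proof -
  note G = surface_groupD[OF \<Gamma>]
  have "\<exists>B\<in>\<Gamma>. \<exists>s. geod A t = mact B (geod C s)" for t
  proof -
    have "proj \<Gamma> (geod A t) \<in> geod_image \<Gamma> C" using sub by (auto simp: geod_image_def)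
    then obtain s where "proj \<Gamma> (geod A t) = proj \<Gamma> (geod C s)" by (auto simp: geod_image_def)
    then show ?thesis
      using proj_eq_iff[OF \<Gamma> geod_in_hplane[OF A] geod_in_hplane[OF C]] by blast
  qed
  then obtain B t1 t2 where B: "B \<in> \<Gamma>" "t1 \<noteq> t2"
      "\<exists>s. geod A t1 = mact B (geod C s)" "\<exists>s. geod A t2 = mact B (geod C s)"
    using two_parameters_same_element[OF surface_group_countable[OF \<Gamma>],
        of "\<lambda>B t. \<exists>s. geod A t = mact B (geod C s)"] by metis
  note BC = geod_mult[OF G(1)[OF B(1)] C]
  obtain s1 s2 where "geod A t1 = geod (B ** C) s1" "geod A t2 = geod (B ** C) s2"
    using B(3,4) unfolding BC by blast
  then obtain s k where "k \<in> {1, -1}" "\<And>t. geod A t = geod (B ** C) (s + k * t)"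
    using geod_eq_if_two_points[OF A SL2R_mult[OF G(1)[OF B(1)] C] _ _ B(2)] by metis
  then show ?thesis using that[OF B(1)] unfolding BC by blast
qed

text \<open>Simplicity speaks of points of the surface, so it relates \<open>s + u\<close> to
  \<open>t + u\<close> by a group element depending on \<open>u\<close>. One \<open>B\<close> serves
  two values of \<open>u\<close>, hence all of them. Then \<open>P ** B\<close> and \<open>Q\<close>
  agree at one point, so by freeness everywhere.\<close>

lemma simple_geod_translates_meet:
  assumes \<Gamma>: "surface_group \<Gamma>" and C: "C \<in> SL2R" and simple: "simple_geod \<Gamma> C"
    and P: "P \<in> \<Gamma>" and Q: "Q \<in> \<Gamma>" and meet: "mact P (geod C s) = mact Q (geod C t)"
  shows "mact P (geod C (s + u)) = mact Q (geod C (t + u))"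
proof -
  note G = surface_groupD[OF \<Gamma>]
  note hC = geod_in_hplane[OF C]
  have "proj \<Gamma> (geod C s) = proj \<Gamma> (mact P (geod C s))"
    using proj_eq_iff[OF \<Gamma> mact_in_hplane[OF G(1)[OF P] hC] hC] P by blast
  also have "\<dots> = proj \<Gamma> (geod C t)"
    unfolding meet using proj_eq_iff[OF \<Gamma> mact_in_hplane[OF G(1)[OF Q] hC] hC] Q by blast
  finally have "proj \<Gamma> (geod C (s + u)) = proj \<Gamma> (geod C (t + u))" for u
    using simple unfolding simple_geod_def by blast
  then have "\<exists>B\<in>\<Gamma>. geod C (s + u) = mact B (geod C (t + u))" for u
    using proj_eq_iff[OF \<Gamma> hC hC] by blast
  then obtain B u1 u2 where B: "B \<in> \<Gamma>" "u1 \<noteq> u2"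
      "geod C (s + u1) = mact B (geod C (t + u1))" "geod C (s + u2) = mact B (geod C (t + u2))"
    using two_parameters_same_element[OF surface_group_countable[OF \<Gamma>],
        of "\<lambda>B u. geod C (s + u) = mact B (geod C (t + u))"] by metis
  have BC: "B ** C \<in> SL2R" using SL2R_mult[OF G(1)[OF B(1)] C] .
  note BC_eq = geod_mult[OF G(1)[OF B(1)] C]
  have m: "geod C (s + u1) = geod (B ** C) (t + u1)" "geod C (s + u2) = geod (B ** C) (t + u2)"
    using B(3,4) BC_eq by simp_all
  have "s + u1 \<noteq> s + u2" using B(2) by simp
  then obtain r k where k: "\<And>u. geod C u = geod (B ** C) (r + k * u)"
    using geod_eq_if_two_points[OF C BC m] by metis
  have "geod (B ** C) (r + k * (s + u1)) = geod (B ** C) (t + u1)"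
    "geod (B ** C) (r + k * (s + u2)) = geod (B ** C) (t + u2)"
    unfolding k[symmetric] m by (rule refl)+
  then have eq: "r + k * (s + u1) = t + u1" "r + k * (s + u2) = t + u2"
    using geod_inj[OF BC] by blast+
  \<comment> \<open>Both parameters advance by the same amount between the two common points, which
    excludes the orientation reversing slope -1.\<close>
  then have "(k - 1) * (u1 - u2) = 0" by (simp add: algebra_simps)
  then have "k = 1" using B(2) by simp
  with eq have "r = t - s" by simp
  have all: "geod C (s + u) = mact B (geod C (t + u))" for u
    using k[of "s + u"] unfolding BC_eq \<open>k = 1\<close> \<open>r = t - s\<close> by simp
  have "mact (P ** B) (geod C (t + 0)) = mact Q (geod C (t + 0))"
    using mact_mult[OF G(1)[OF P] G(1)[OF B(1)] hC] all[of 0] meet by simp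
  then have "mact (P ** B) (geod C (t + u)) = mact Q (geod C (t + u))"
    using mact_eq_if_eq_at[OF \<Gamma> G(3)[OF P B(1)] Q hC _ hC] by blast
  then show ?thesis
    using mact_mult[OF G(1)[OF P] G(1)[OF B(1)] hC] all by simp
qed

text \<open>
  A matrix stands for the unit tangent vector of its geodesic at time \<open>0\<close>, so compactness arguments
  for tangent vectors can be carried out in the space of matrices.
\<close>

definition leaf_frames :: "(real^2^2) set \<Rightarrow> lamination \<Rightarrow> (real^2^2) set" where
  "leaf_frames \<Gamma> L = {A \<in> SL2R. geod_image \<Gamma> A \<in> L}"

text \<open>Lets every leaf vector be taken at time \<open>0\<close>, so that a matrix alone encodes
  it.\<close>

lemma leaf_frames_shift:
  assumes "A \<in> leaf_frames \<Gamma> L"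
  obtains B where "B \<in> leaf_frames \<Gamma> L" "\<And>t. geod B t = geod A (s + t)" "\<And>t. geod_vel B t = geod_vel A (s + t)"
proof -
  have A: "A \<in> SL2R" using assms by (simp add: leaf_frames_def)
  then obtain B where B: "B \<in> SL2R" "\<And>t. geod B t = geod A (s + t)" using geod_shift by blast
  have "geod_image \<Gamma> B = geod_image \<Gamma> A"
    unfolding geod_image_def B(2)
  proof safe
    fix t
    show "proj \<Gamma> (geod A (s + t)) \<in> range (\<lambda>t. proj \<Gamma> (geod A t))" by blast
    have "proj \<Gamma> (geod A t) = proj \<Gamma> (geod A (s + (t - s)))" by simp
    then show "proj \<Gamma> (geod A t) \<in> range (\<lambda>t. proj \<Gamma> (geod A (s + t)))" by blast
  qed
  then have "B \<in> leaf_frames \<Gamma> L" using assms B by (simp add: leaf_frames_def)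
  moreover have "geod_vel B t = geod_vel A (s + t)" for t
    using geod_vel_reparam[OF A, of B s 1 t] B(2) by simp
  ultimately show ?thesis using that B(2) by blast
qed

lemma leaf_vectors_eq: "leaf_vectors \<Gamma> L = (\<lambda>A. (geod A 0, geod_vel A 0)) ` leaf_frames \<Gamma> L"
proof
  show "leaf_vectors \<Gamma> L \<subseteq> (\<lambda>A. (geod A 0, geod_vel A 0)) ` leaf_frames \<Gamma> L"
  proof
    fix x assume "x \<in> leaf_vectors \<Gamma> L"
    then obtain A t where A: "x = (geod A t, geod_vel A t)" "A \<in> leaf_frames \<Gamma> L"
      by (auto simp: leaf_vectors_def leaf_frames_def)
    obtain B where "B \<in> leaf_frames \<Gamma> L" "geod B 0 = geod A (t + 0)" "geod_vel B 0 = geod_vel A (t + 0)"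
      using leaf_frames_shift[OF A(2)] by metis
    then show "x \<in> (\<lambda>A. (geod A 0, geod_vel A 0)) ` leaf_frames \<Gamma> L"
      using A(1) by force
  qed
qed (auto simp: leaf_vectors_def leaf_frames_def)

text \<open>Disjointness makes the two leaves equal, so \<open>A\<close> and \<open>B\<close> are
  both translates of one simple geodesic \<open>C\<close>, and translates of \<open>C\<close> that
  meet agree. The sign \<open>k * k'\<close> compares the orientations of \<open>A\<close> and
  \<open>B\<close> through that of \<open>C\<close>.\<close>

lemma leaves_through_point_coincide:
  assumes \<Gamma>: "surface_group \<Gamma>" and L: "geodesic_lamination \<Gamma> L"
    and A: "A \<in> leaf_frames \<Gamma> L" and B: "B \<in> leaf_frames \<Gamma> L" and eq: "geod A s0 = geod B t0"
  obtains k where "k \<in> {1, -1}" "\<And>u. geod A (s0 + u) = geod B (t0 + k * u)"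
proof -
  have AS: "A \<in> SL2R" "geod_image \<Gamma> A \<in> L" and BS: "B \<in> SL2R" "geod_image \<Gamma> B \<in> L"
    using A B by (auto simp: leaf_frames_def)
  have "proj \<Gamma> (geod A s0) \<in> geod_image \<Gamma> A \<inter> geod_image \<Gamma> B"
    unfolding geod_image_def by (metis IntI eq rangeI)
  then have same: "geod_image \<Gamma> A = geod_image \<Gamma> B"
    using L AS BS unfolding geodesic_lamination_def pairwise_def disjnt_def by blast
  obtain C where C: "C \<in> SL2R" "simple_geod \<Gamma> C" "geod_image \<Gamma> A = geod_image \<Gamma> C"
    using L AS unfolding geodesic_lamination_def by blast
  obtain P s k where P: "P \<in> \<Gamma>" "k \<in> {1, -1::real}" "\<And>t. geod A t = mact P (geod C (s + k * t))"
    using geod_image_subset_imp_translate[OF \<Gamma> AS(1) C(1) eq_refl[OF C(3)]] by metis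
  obtain Q s' k' where Q: "Q \<in> \<Gamma>" "k' \<in> {1, -1::real}" "\<And>t. geod B t = mact Q (geod C (s' + k' * t))"
    using geod_image_subset_imp_translate[OF \<Gamma> BS(1) C(1) eq_refl[OF trans[OF same[symmetric] C(3)]]] by metis
  have "mact P (geod C (s + k * s0)) = mact Q (geod C (s' + k' * t0))"
    using eq P(3) Q(3) by simp
  note meet = simple_geod_translates_meet[OF \<Gamma> C(1,2) P(1) Q(1) this]
  have "geod A (s0 + u) = geod B (t0 + k * k' * u)" for u
  proof -
    have "s' + k' * (t0 + k * k' * u) = s' + k' * t0 + k * u" using Q(2) by (auto simp: algebra_simps)
    moreover have "s + k * (s0 + u) = s + k * s0 + k * u" by (simp add: algebra_simps)
    ultimately show ?thesis
      unfolding P(3)[of "s0 + u"] Q(3)[of "t0 + k * k' * u"] using meet[of "k * u"] by (simp only:)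
  qed
  moreover have "k * k' \<in> {1, -1}" using P(2) Q(2) by auto
  ultimately show ?thesis using that by blast
qed

subsection \<open>Continuity of the leaf direction\<close>

lemma tendsto_mact:
  assumes "(B \<longlongrightarrow> C) F" "(f \<longlongrightarrow> z) F" "C \<in> SL2R" "z \<in> hplane"
  shows "((\<lambda>n. mact (B n) (f n)) \<longlongrightarrow> mact C z) F"
  unfolding mact_eq
  by (intro tendsto_intros assms(1,2)) (use mact_denom_nonzero[OF assms(3,4)] in auto)

lemma tendsto_geod:
  assumes "(B \<longlongrightarrow> C) F" "C \<in> SL2R"
  shows "((\<lambda>n. geod (B n) t) \<longlongrightarrow> geod C t) F"
  unfolding geod_def by (intro tendsto_mact assms tendsto_const imaginary_axis_in_hplane)

lemma tendsto_geod_vel: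
  assumes "(B \<longlongrightarrow> C) F" "C \<in> SL2R" "\<And>n. B n \<in> SL2R"
  shows "((\<lambda>n. geod_vel (B n) t) \<longlongrightarrow> geod_vel C t) F"
  unfolding geod_vel_eq[OF assms(2)] geod_vel_eq[OF assms(3)]
  by (intro tendsto_intros assms(1)) (use mact_denom_nonzero[OF assms(2) imaginary_axis_in_hplane] in auto)

text \<open>If the base point is the quotient \<open>?n / ?d\<close>, its height is
  \<open>1 / (cmod ?d)\<^sup>2\<close>, and the right side becomes the sum of the squared moduli of
  \<open>?n\<close> and \<open>?d\<close>, that is, of the squared entries. So the base point alone
  bounds the frame.\<close>

lemma norm_SL2R:
  assumes "A \<in> SL2R"
  shows "(norm A)\<^sup>2 = (1 + (cmod (geod A 0))\<^sup>2) / Im (geod A 0)"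
proof -
  let ?n = "of_real (A$1$1) * \<i> + of_real (A$1$2)" and ?d = "of_real (A$2$1) * \<i> + of_real (A$2$2)"
  have hi: "\<i> \<in> hplane" by (simp add: hplane_def)
  have d: "?d \<noteq> 0" by (rule mact_denom_nonzero[OF assms hi])
  have Im: "Im (geod A 0) = 1 / (cmod ?d)\<^sup>2"
    using Im_mact[OF assms hi] by (simp add: geod_def)
  have "cmod (geod A 0) = cmod ?n / cmod ?d"
    by (simp add: geod_def mact_eq norm_divide)
  then have "(cmod (geod A 0))\<^sup>2 * (cmod ?d)\<^sup>2 = (cmod ?n)\<^sup>2"
    using d by (simp add: power_divide)
  then have "(1 + (cmod (geod A 0))\<^sup>2) / Im (geod A 0) = (cmod ?d)\<^sup>2 + (cmod ?n)\<^sup>2"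
    unfolding Im by (simp add: distrib_right)
  also have "\<dots> = (A$2$1)\<^sup>2 + (A$2$2)\<^sup>2 + (A$1$1)\<^sup>2 + (A$1$2)\<^sup>2"
    by (simp add: cmod_power2)
  also have "\<dots> = (norm A)\<^sup>2"
    by (simp add: norm_vec_def L2_set_def sum_2)
  finally show ?thesis by simp
qed

lemma SL2R_convergent_subsequence:
  assumes B: "\<And>n. B n \<in> SL2R" and lim: "(\<lambda>n. geod (B n) 0) \<longlonglongrightarrow> z" and z: "z \<in> hplane"
  obtains C r where "C \<in> SL2R" "strict_mono r" "(B \<circ> r) \<longlonglongrightarrow> C"
proof -
  have "(\<lambda>n. (norm (B n))\<^sup>2) \<longlonglongrightarrow> (1 + (cmod z)\<^sup>2) / Im z"
    unfolding norm_SL2R[OF B] by (intro tendsto_intros lim) (use z in \<open>simp add: hplane_def\<close>)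
  then have "Bseq (\<lambda>n. (norm (B n))\<^sup>2)" by (rule Cauchy_Bseq[OF LIMSEQ_imp_Cauchy])
  then obtain K where K: "norm ((norm (B n))\<^sup>2) \<le> K" for n by (rule BseqE) blast
  have "norm (B n) \<le> 1 + K" for n
  proof -
    have "0 \<le> (norm (B n) - 1/2)\<^sup>2" by simp
    then have "norm (B n) \<le> 1 + (norm (B n))\<^sup>2" by (simp add: power2_eq_square algebra_simps)
    with K[of n] show ?thesis by simp
  qed
  then have "bounded (range B)" unfolding bounded_iff by auto
  then obtain C r where r: "strict_mono r" "(B \<circ> r) \<longlonglongrightarrow> C"
    using bounded_imp_convergent_subsequence by blast
  have "(\<lambda>n. B (r n) $1$1 * B (r n) $2$2 - B (r n) $1$2 * B (r n) $2$1)
      \<longlonglongrightarrow> C$1$1 * C$2$2 - C$1$2 * C$2$1"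
    using r(2) unfolding o_def by (intro tendsto_intros)
  moreover have "B (r n) $1$1 * B (r n) $2$2 - B (r n) $1$2 * B (r n) $2$1 = 1" for n
    using B[of "r n"] by (simp add: SL2R_iff)
  ultimately have "C \<in> SL2R" by (simp add: SL2R_iff LIMSEQ_const_iff)
  then show ?thesis using that r by blast
qed

text \<open>
  The preimage of \<open>C\<close> under \<open>A\<close> is compared with the imaginary axis: a change of sign of the real
  part means that \<open>C\<close> crosses \<open>A\<close>, a condition that is stable under small perturbations of \<open>C\<close>.
\<close>

lemma geod_through_same_point:
  assumes A: "A \<in> SL2R" and C: "C \<in> SL2R" and eq: "geod C 0 = geod A 0"
  shows "(\<exists>k\<in>{1, -1}. geod_vel C 0 = of_real k * geod_vel A 0) \<or>
    Re (mact (matrix_inv A) (geod C 1)) * Re (mact (matrix_inv A) (geod C (-1))) < 0"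
proof -
  define M where "M = matrix_inv A ** C"
  note A' = SL2R_matrix_inv[OF A]
  have M: "M \<in> SL2R" unfolding M_def using SL2R_mult A' C by blast
  have Mt: "mact M (\<i> * of_real (exp t)) = mact (matrix_inv A) (geod C t)" for t
    unfolding M_def geod_def using mact_mult[OF A'(1) C imaginary_axis_in_hplane] .
  have "mact M (\<i> * of_real 1) = \<i> * of_real 1"
    using Mt[of 0] eq mact_matrix_inv(1)[OF A imaginary_axis_in_hplane[of 0]] by (simp add: geod_def)
  \<comment> \<open>\<open>M\<close> fixes \<i>, so it is a rotation matrix with rows
    \<open>p, q\<close> and \<open>- q, p\<close>.\<close>
  from mact_axis_eq[OF M this] have m: "M$1$2 = - M$2$1" "M$1$1 = M$2$2" by simp_all
  define p where "p = M$2$2"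
  define q where "q = M$1$2"
  have pq: "p\<^sup>2 + q\<^sup>2 = 1"
    using M m by (simp add: SL2R_iff p_def q_def power2_eq_square)
  have entries: "M$1$1 = p" "M$1$2 = q" "M$2$1 = - q" "M$2$2 = p"
    using m by (simp_all add: p_def q_def)
  \<comment> \<open>The sign is that of \<open>p * q * (1 - exp (2 * t))\<close>, which changes at
    \<open>t = 0\<close> unless \<open>p * q = 0\<close>.\<close>
  have Re: "Re (mact (matrix_inv A) (geod C t)) = p * q * (1 - (exp t)\<^sup>2) / (p\<^sup>2 + (q * exp t)\<^sup>2)" for t
    unfolding Mt[symmetric] mact_eq[of M] entries
    by (simp add: Re_divide power2_eq_square algebra_simps del: of_real_exp)
  show ?thesis
  proof (cases "p = 0 \<or> q = 0")
    \<comment> \<open>Here \<open>M\<close> is plus or minus the identity or acts as the half-turn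
      about \<i>. It maps the axis to itself, so \<open>C\<close> is \<open>A\<close> up to
      orientation.\<close>
    case True
    have "\<exists>k\<in>{1, -1}. \<forall>t. mact M (\<i> * of_real (exp t)) = \<i> * of_real (exp (k * t))"
    proof (cases "q = 0")
      case True
      then have "p \<noteq> 0" using pq by auto
      with True show ?thesis by (auto simp: mact_eq entries)
    next
      case False
      with True show ?thesis
        by (auto simp: mact_eq entries exp_minus field_simps del: of_real_exp)
    qed
    then obtain k where k: "k \<in> {1, -1}" "\<And>t. mact M (\<i> * of_real (exp t)) = \<i> * of_real (exp (k * t))"
      by blast
    have "geod C t = geod A (0 + k * t)" for t
      using mact_matrix_inv(2)[OF A geod_in_hplane[OF C], of t] Mt[of t] k(2)[of t] by (simp add: geod_def[of A])
    from geod_vel_reparam[OF A this, of 0] k(1) show ?thesis by auto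
  next
    case False
    then have d: "p\<^sup>2 + (q * exp t)\<^sup>2 > 0" for t by (simp add: sum_power2_gt_zero_iff)
    have e: "1 - (exp (1::real))\<^sup>2 < 0" "1 - (exp (-1::real))\<^sup>2 > 0"
      by (simp_all add: power_less_one_iff)
    have "Re (mact (matrix_inv A) (geod C 1)) * Re (mact (matrix_inv A) (geod C (-1))) =
        (p * q)\<^sup>2 / ((p\<^sup>2 + (q * exp 1)\<^sup>2) * (p\<^sup>2 + (q * exp (-1))\<^sup>2)) * ((1 - (exp 1)\<^sup>2) * (1 - (exp (-1))\<^sup>2))"
      unfolding Re by (simp add: power2_eq_square)
    also have "\<dots> < 0"
      using d[of 1] d[of "-1"] e False by (intro mult_pos_neg divide_pos_pos mult_neg_pos mult_pos_pos) auto
    finally show ?thesis by simp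
  qed
qed

text \<open>By the intermediate value theorem a change of sign forces \<open>B\<close> to meet
  \<open>A\<close>. The two then coincide up to reparametrisation, so the real part vanishes
  identically.\<close>

lemma leaves_do_not_cross:
  assumes \<Gamma>: "surface_group \<Gamma>" and L: "geodesic_lamination \<Gamma> L"
    and A: "A \<in> leaf_frames \<Gamma> L" and B: "B \<in> leaf_frames \<Gamma> L"
  shows "\<not> Re (mact (matrix_inv A) (geod B 1)) * Re (mact (matrix_inv A) (geod B (-1))) < 0"
proof
  have AS: "A \<in> SL2R" and BS: "B \<in> SL2R" using A B by (auto simp: leaf_frames_def)
  note A' = SL2R_matrix_inv[OF AS]
  define f where "f t = Re (mact (matrix_inv A) (geod B t))" for t
  assume "Re (mact (matrix_inv A) (geod B 1)) * Re (mact (matrix_inv A) (geod B (-1))) < 0"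
  then have neg: "f 1 * f (-1) < 0" by (simp add: f_def)
  have "f = (\<lambda>t. Re (geod (matrix_inv A ** B) t))"
    unfolding f_def geod_mult[OF A'(1) BS] ..
  then have cont: "continuous_on {-1..1} f"
    using continuous_on_geod[OF SL2R_mult[OF A'(1) BS]] by (simp add: continuous_on_Re)
  have "\<exists>t. f t = 0"
  proof (cases "f 1 < 0")
    case True
    with neg have "f (-1) > 0" by (simp add: mult_less_0_iff)
    then show ?thesis using IVT2'[of f 1 0 "-1"] cont True by force
  next
    case False
    with neg have "f 1 > 0" "f (-1) < 0" by (auto simp: mult_less_0_iff)
    then show ?thesis using IVT'[of f "-1" 0 1] cont by force
  qed
  then obtain t where t: "f t = 0" by blast
  define w where "w = mact (matrix_inv A) (geod B t)"
  have "w \<in> hplane" unfolding w_def by (intro mact_in_hplane A' geod_in_hplane BS)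
  then have "w = \<i> * of_real (exp (ln (Im w)))"
    using t by (simp add: hplane_def complex_eq_iff f_def w_def del: of_real_exp)
  then have "geod A (ln (Im w)) = mact A w" by (simp add: geod_def)
  also have "\<dots> = geod B t"
    unfolding w_def by (rule mact_matrix_inv(2)[OF AS geod_in_hplane[OF BS]])
  finally obtain k where "\<And>u. geod B (t + u) = geod A (ln (Im w) + k * u)"
    using leaves_through_point_coincide[OF \<Gamma> L B A, of t "ln (Im w)"] by metis
  then have "geod B (t + (1 - t)) = geod A (ln (Im w) + k * (1 - t))" by blast
  then have "f 1 = 0"
    using mact_matrix_inv(1)[OF AS imaginary_axis_in_hplane] by (simp add: f_def geod_def[of A])
  with neg show False by simp
qed

text \<open>Frames violating the claim have a convergent subsequence, whose limit \<open>C\<close>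
  passes through the base point of \<open>A\<close> in another direction and so crosses
  \<open>A\<close>. Whether \<open>C\<close> is itself tangent to a leaf is left open: crossing is
  stable, so some \<open>B (r n)\<close> already crosses \<open>A\<close>, and that one is a leaf
  frame.\<close>

lemma leaf_direction_continuous:
  assumes \<Gamma>: "surface_group \<Gamma>" and L: "geodesic_lamination \<Gamma> L" and A: "A \<in> leaf_frames \<Gamma> L" and "\<delta> > 0"
  obtains \<epsilon> where "\<epsilon> > 0"
    "\<And>B. B \<in> leaf_frames \<Gamma> L \<Longrightarrow> dist (geod B 0) (geod A 0) < \<epsilon> \<Longrightarrow>
       \<exists>k\<in>{1, -1}. dist (geod_vel B 0) (of_real k * geod_vel A 0) < \<delta>"
proof (rule ccontr)
  note AS = A[unfolded leaf_frames_def, simplified, THEN conjunct1]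
  assume "\<not> thesis"
  then have "\<forall>n. \<exists>B. B \<in> leaf_frames \<Gamma> L \<and> dist (geod B 0) (geod A 0) < inverse (real (Suc n)) \<and>
      (\<forall>k\<in>{1, -1}. dist (geod_vel B 0) (of_real k * geod_vel A 0) \<ge> \<delta>)"
    using that by (metis inverse_positive_iff_positive not_less of_nat_0_less_iff zero_less_Suc)
  then obtain B where B: "\<And>n. B n \<in> leaf_frames \<Gamma> L"
      "\<And>n. dist (geod (B n) 0) (geod A 0) < inverse (real (Suc n))"
      "\<And>n k. k \<in> {1, -1} \<Longrightarrow> dist (geod_vel (B n) 0) (of_real k * geod_vel A 0) \<ge> \<delta>"
    by metis
  have BS: "B n \<in> SL2R" for n using B(1)[of n] by (simp add: leaf_frames_def)
  have lim: "(\<lambda>n. geod (B n) 0) \<longlonglongrightarrow> geod A 0"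
  proof (rule metric_tendsto_imp_tendsto[OF LIMSEQ_inverse_real_of_nat])
    show "\<forall>\<^sub>F n in sequentially. dist (geod (B n) 0) (geod A 0) \<le> dist (inverse (real (Suc n))) 0"
      using B(2) by (intro always_eventually allI) (simp add: less_imp_le)
  qed
  then obtain C r where C: "C \<in> SL2R" "strict_mono r" "(B \<circ> r) \<longlonglongrightarrow> C"
    using SL2R_convergent_subsequence[of B, OF BS _ geod_in_hplane[OF AS]] by blast
  have "(\<lambda>n. geod (B (r n)) 0) \<longlonglongrightarrow> geod A 0"
    using LIMSEQ_subseq_LIMSEQ[OF lim C(2)] by (simp add: o_def)
  then have C0: "geod C 0 = geod A 0"
    using tendsto_geod[OF C(3,1), of 0] LIMSEQ_unique by (auto simp: o_def)
  have vel: "(\<lambda>n. geod_vel (B (r n)) 0) \<longlonglongrightarrow> geod_vel C 0"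
    using tendsto_geod_vel[OF C(3,1), of 0] BS by (simp add: o_def)
  have "dist (geod_vel C 0) (of_real k * geod_vel A 0) \<ge> \<delta>" if "k \<in> {1, -1}" for k
    using B(3)[OF that] by (intro tendsto_lowerbound[OF tendsto_dist[OF vel tendsto_const]]) auto
  then have "\<not> (\<exists>k\<in>{1, -1}. geod_vel C 0 = of_real k * geod_vel A 0)"
    using \<open>\<delta> > 0\<close> by fastforce
  then have neg: "Re (mact (matrix_inv A) (geod C 1)) * Re (mact (matrix_inv A) (geod C (-1))) < 0"
    using geod_through_same_point[OF AS C(1) C0] by blast
  have "(\<lambda>n. Re (mact (matrix_inv A) (geod ((B \<circ> r) n) t))) \<longlonglongrightarrow> Re (mact (matrix_inv A) (geod C t))" for t
    by (intro tendsto_Re tendsto_mact tendsto_const tendsto_geod C SL2R_matrix_inv AS geod_in_hplane)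
  from order_tendstoD(2)[OF tendsto_mult[OF this[of 1] this[of "-1"]] neg]
  obtain n where "Re (mact (matrix_inv A) (geod (B (r n)) 1)) * Re (mact (matrix_inv A) (geod (B (r n)) (-1))) < 0"
    using eventually_happens trivial_limit_sequentially by (force simp: o_def)
  with leaves_do_not_cross[OF \<Gamma> L A B(1)] show False by blast
qed

subsection \<open>Transverse arcs and test functions\<close>

lemma leaf_direction_unique:
  assumes "surface_group \<Gamma>" "geodesic_lamination \<Gamma> L"
    and A: "A \<in> leaf_frames \<Gamma> L" and B: "B \<in> leaf_frames \<Gamma> L" and "geod B 0 = geod A 0"
  shows "\<exists>k\<in>{1, -1}. geod_vel B 0 = of_real k * geod_vel A 0"
proof -
  obtain k where k: "k \<in> {1, -1}" "\<And>u. geod B (0 + u) = geod A (0 + k * u)"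
    using leaves_through_point_coincide[OF assms(1,2) B A assms(5)] by blast
  have "A \<in> SL2R" using A by (simp add: leaf_frames_def)
  from geod_vel_reparam[OF this, of B 0 k 0] k show ?thesis by auto
qed

text \<open>The lift \<open>C\<close> supplied by the definition of a lamination may miss
  \<open>z\<close>; a translate under \<open>\<Gamma>\<close> passes through \<open>z\<close> and
  has the same image.\<close>

lemma leaf_frame_exists:
  assumes \<Gamma>: "surface_group \<Gamma>" and L: "geodesic_lamination \<Gamma> L" and z: "z \<in> hplane" "proj \<Gamma> z \<in> \<Union>L"
  obtains A where "A \<in> leaf_frames \<Gamma> L" "geod A 0 = z"
proof -
  note G = surface_groupD[OF \<Gamma>]
  obtain l where l: "l \<in> L" "proj \<Gamma> z \<in> l" using z by blast
  then obtain C where C: "C \<in> SL2R" "l = geod_image \<Gamma> C"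
    using L unfolding geodesic_lamination_def by blast
  then obtain t where "proj \<Gamma> z = proj \<Gamma> (geod C t)"
    using l by (auto simp: geod_image_def)
  then obtain B where B: "B \<in> \<Gamma>" "z = mact B (geod C t)"
    using proj_eq_iff[OF \<Gamma> z(1) geod_in_hplane[OF C(1)]] by blast
  have "proj \<Gamma> (geod (B ** C) s) = proj \<Gamma> (geod C s)" for s
    unfolding geod_mult[OF G(1)[OF B(1)] C(1)]
    using proj_eq_iff[OF \<Gamma> mact_in_hplane[OF G(1)[OF B(1)] geod_in_hplane[OF C(1)]] geod_in_hplane[OF C(1)]] B(1)
    by blast
  then have "geod_image \<Gamma> (B ** C) \<in> L" using C l by (simp add: geod_image_def)
  then have "B ** C \<in> leaf_frames \<Gamma> L"
    by (simp add: leaf_frames_def SL2R_mult G(1) B C)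
  then obtain A where "A \<in> leaf_frames \<Gamma> L" "\<And>s. geod A s = geod (B ** C) (t + s)"
    using leaf_frames_shift by metis
  with that[of A] B show ?thesis by (simp add: geod_mult G(1) C)
qed

lemma perpendicular_geod:
  assumes "A \<in> SL2R"
  obtains D where "D \<in> SL2R" "geod D 0 = geod A 0" "geod_vel D 0 = \<i> * geod_vel A 0"
proof
  \<comment> \<open>The rotation matrix of angle pi/4 fixes \<i> and turns tangent vectors there by
    a right angle, since the square of \<open>(1 - \<i>) / sqrt 2\<close> is
    \<open>- \<i>\<close>.\<close>
  let ?R = "vector [vector [1 / sqrt 2, 1 / sqrt 2], vector [- 1 / sqrt 2, 1 / sqrt 2]] :: real^2^2"
  have R: "?R \<in> SL2R" by (simp add: SL2R_iff)
  show D: "A ** ?R \<in> SL2R" using SL2R_mult[OF assms R] .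
  have ne: "1 - \<i> \<noteq> 0" by (simp add: complex_eq_iff)
  have s: "complex_of_real (sqrt 2) * complex_of_real (sqrt 2) = 2" "complex_of_real (sqrt 2) \<noteq> 0"
    unfolding of_real_mult[symmetric] by simp_all
  have "geod ?R 0 = \<i>"
  proof -
    have "(1 + \<i>) / (1 - \<i>) = \<i>" using ne by (simp add: field_simps)
    moreover have "geod ?R 0 = ((1 + \<i>) / of_real (sqrt 2)) / ((1 - \<i>) / of_real (sqrt 2))"
      by (simp add: geod_def mact_eq add_divide_distrib diff_divide_distrib add.commute)
    ultimately show ?thesis using s by simp
  qed
  then show "geod (A ** ?R) 0 = geod A 0"
    unfolding geod_mult[OF assms R] by (simp add: geod_def)
  let ?d = "of_real (A$2$1) * \<i> + of_real (A$2$2)"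
  have d: "?d \<noteq> 0" using mact_denom_nonzero[OF assms imaginary_axis_in_hplane[of 0]] by simp
  have "of_real ((A ** ?R)$2$1) * \<i> + of_real ((A ** ?R)$2$2) = ?d * (1 - \<i>) / of_real (sqrt 2)"
    by (simp add: matrix_matrix_mult_def sum_2 algebra_simps add_divide_distrib diff_divide_distrib)
  then have "geod_vel (A ** ?R) 0 = \<i> / (?d * (1 - \<i>) / of_real (sqrt 2))\<^sup>2"
    unfolding geod_vel_eq[OF D] by simp
  also have "(?d * (1 - \<i>) / of_real (sqrt 2))\<^sup>2 = ?d\<^sup>2 * (- \<i>)"
    using s by (simp add: power2_eq_square field_simps)
  also have "\<i> / (?d\<^sup>2 * (- \<i>)) = \<i> * (\<i> / ?d\<^sup>2)" by simp
  finally show "geod_vel (A ** ?R) 0 = \<i> * geod_vel A 0"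
    unfolding geod_vel_eq[OF assms] by simp
qed

text \<open>Replaces parallelism by a polynomial equation, so that being non-parallel becomes an
  open condition and being parallel a closed one.\<close>

lemma Im_mult_cnj_eq_0: "x / v \<in> \<real> \<Longrightarrow> Im (x * cnj v) = 0"
  by (cases "v = 0") (auto elim!: Reals_cases simp: field_simps)

lemma continuous_on_geod_arc: "D \<in> SL2R \<Longrightarrow> continuous_on S (geod_arc D a b)"
  unfolding geod_arc_def[abs_def]
  by (rule continuous_on_compose2[OF continuous_on_geod[of D UNIV]]) (auto intro!: continuous_intros)

text \<open>The arc is perpendicular to the leaf at its centre. Being non-parallel is open in a pair
  of vectors, and both vary continuously: the velocity of \<open>D\<close>, and the leaf vectors up
  to sign.\<close>

lemma transverse_arc_exists:
  assumes \<Gamma>: "surface_group \<Gamma>" and L: "geodesic_lamination \<Gamma> L" and A: "A \<in> leaf_frames \<Gamma> L"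
    and D: "D \<in> SL2R" "geod D 0 = geod A 0" "geod_vel D 0 = \<i> * geod_vel A 0"
  obtains e where "e > 0" "transverse_arc \<Gamma> L (geod_arc D (-e) e)"
proof -
  have AS: "A \<in> SL2R" using A by (simp add: leaf_frames_def)
  let ?w = "geod_vel A 0"
  have "open {y :: complex \<times> complex. Im (fst y * cnj (snd y)) \<noteq> 0}"
    by (intro open_Collect_neq continuous_intros)
  moreover have "(geod_vel D 0, ?w) \<in> {y. Im (fst y * cnj (snd y)) \<noteq> 0}"
  proof -
    have "Im (\<i> * ?w * cnj ?w) = (cmod ?w)\<^sup>2" unfolding cmod_power2 by (simp add: power2_eq_square)
    then have "Im (\<i> * ?w * cnj ?w) \<noteq> 0"
      using geod_vel_nonzero[OF AS, of 0] by (simp only: norm_eq_zero zero_eq_power2 not_False_eq_True)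
    then show ?thesis by (simp only: D(3) mem_Collect_eq fst_conv snd_conv not_False_eq_True)
  qed
  ultimately obtain \<rho> where \<rho>: "\<rho> > 0"
    "ball (geod_vel D 0, ?w) \<rho> \<subseteq> {y. Im (fst y * cnj (snd y)) \<noteq> 0}"
    by (meson open_contains_ball)
  have nonpar: "Im (x * cnj v) \<noteq> 0"
    if "dist x (geod_vel D 0) < \<rho> / 2" "k \<in> {1, -1}" "dist v (of_real k * ?w) < \<rho> / 2" for x v k
  proof -
    \<comment> \<open>Moving the sign from \<open>?w\<close> to \<open>v\<close> lets one ball
      handle both orientations of a leaf.\<close>
    have "dist (of_real k * v) ?w < \<rho> / 2"
      using that(2,3) by (auto simp: dist_norm norm_minus_commute add.commute)
    moreover have "dist (x, of_real k * v) (geod_vel D 0, ?w) \<le> dist x (geod_vel D 0) + dist (of_real k * v) ?w"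
      unfolding dist_Pair_Pair by (rule sqrt_sum_squares_le_sum) auto
    ultimately have "(x, of_real k * v) \<in> ball (geod_vel D 0, ?w) \<rho>"
      using that(1) by (simp add: dist_commute)
    then have "Im (x * cnj (of_real k * v)) \<noteq> 0" using \<rho>(2) by auto
    then show ?thesis using that(2) by auto
  qed
  obtain \<epsilon> where \<epsilon>: "\<epsilon> > 0"
    "\<And>B. B \<in> leaf_frames \<Gamma> L \<Longrightarrow> dist (geod B 0) (geod A 0) < \<epsilon> \<Longrightarrow>
       \<exists>k\<in>{1, -1}. dist (geod_vel B 0) (of_real k * ?w) < \<rho> / 2"
    using leaf_direction_continuous[OF \<Gamma> L A, of "\<rho> / 2"] \<rho>(1) by auto
  obtain e1 where e1: "e1 > 0" "\<And>u. dist u 0 < e1 \<Longrightarrow> dist (geod D u) (geod D 0) < \<epsilon>"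
    using continuous_on_geod[OF D(1), of UNIV] \<epsilon>(1) unfolding continuous_on_iff by (metis UNIV_I)
  obtain e2 where e2: "e2 > 0" "\<And>u. dist u 0 < e2 \<Longrightarrow> dist (geod_vel D u) (geod_vel D 0) < \<rho> / 2"
    using continuous_on_geod_vel[OF D(1), of UNIV] \<rho>(1) unfolding continuous_on_iff
    by (metis UNIV_I half_gt_zero)
  \<comment> \<open>Halving keeps the whole closed arc, end points included, strictly inside both
    bounds.\<close>
  define e where "e = min e1 e2 / 2"
  have e: "e > 0" "e < e1" "e < e2" using e1(1) e2(1) by (auto simp: e_def)
  have arc: "geod_arc D (-e) e = (\<lambda>t. geod D (-e + 2 * e * t))" by (simp add: geod_arc_def[abs_def] algebra_simps)
  have "transverse_arc \<Gamma> L (geod_arc D (-e) e)"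
    unfolding transverse_arc_def
  proof (intro conjI exI ballI allI impI)
    show "geod_arc D (-e) e ` {0..1} \<subseteq> hplane"
      using geod_in_hplane[OF D(1)] by (auto simp: geod_arc_def)
    let ?c' = "\<lambda>t. of_real (2 * e) * geod_vel D (-e + 2 * e * t)"
    show "continuous_on {0..1} ?c'"
      by (intro continuous_intros continuous_on_compose2[OF continuous_on_geod_vel[OF D(1), of UNIV]]) auto
    fix t :: real assume t: "t \<in> {0..1}"
    let ?u = "-e + 2 * e * t"
    show "(geod_arc D (-e) e has_vector_derivative ?c' t) (at t within {0..1})"
      unfolding arc by (rule has_vector_derivative_at_within[OF has_vector_derivative_geod_affine[OF D(1)]])
    show "?c' t \<noteq> 0" using e geod_vel_nonzero[OF D(1)] by simp
    fix v assume "(geod_arc D (-e) e t, v) \<in> leaf_vectors \<Gamma> L"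
    then obtain B where B: "B \<in> leaf_frames \<Gamma> L" "geod B 0 = geod D ?u" "geod_vel B 0 = v"
      by (auto simp: leaf_vectors_eq arc)
    have "0 \<le> e * t" "e * t \<le> e" using t e(1) by (simp_all add: mult_left_le)
    then have "\<bar>?u\<bar> \<le> e" by (simp add: abs_le_iff)
    then have u: "dist ?u 0 < e1" "dist ?u 0 < e2" using e by (auto simp: dist_real_def)
    have "\<exists>k\<in>{1, -1}. dist v (of_real k * ?w) < \<rho> / 2"
      using \<epsilon>(2)[OF B(1)] e1(2)[OF u(1)] unfolding B(2,3) D(2) by blast
    then obtain k where "k \<in> {1, -1}" "dist v (of_real k * ?w) < \<rho> / 2" by blast
    from nonpar[OF e2(2)[OF u(2)] this] show "?c' t / v \<notin> \<real>"
      using Im_mult_cnj_eq_0[of "?c' t" v] e(1) by (auto simp: mult.assoc)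
  qed
  with e(1) that show ?thesis by blast
qed

text \<open>A tent of height \<open>r\<close> around \<open>p\<close> and its opposite vector. The
  minimum makes it even, and it is nonzero exactly within distance \<open>r\<close> of one of the
  two.\<close>

definition even_bump :: "complex \<times> complex \<Rightarrow> real \<Rightarrow> complex \<times> complex \<Rightarrow> real" where
  "even_bump p r x = max 0 (r - min (dist x p) (dist x (fst p, - snd p)))"

lemma even_bump_sign:
  assumes "k \<in> {1, -1}"
  shows "even_bump p r (z, of_real k * v) = even_bump p r (z, v)"
proof -
  have d: "dist (- a) b = dist a (- b)" for a b :: complex
    using dist_minus[of a "- b"] by simp
  have "dist (z, - v) p = dist (z, v) (fst p, - snd p)" "dist (z, - v) (fst p, - snd p) = dist (z, v) p"
    using d by (cases p; simp add: dist_Pair_Pair)+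
  with assms show ?thesis by (auto simp: even_bump_def min.commute)
qed

lemma even_bump_Lipschitz: "\<bar>even_bump p r x - even_bump p r y\<bar> \<le> dist x y"
proof -
  have le: "\<bar>max 0 (r - min a a') - max 0 (r - min b b')\<bar> \<le> d"
    if "\<bar>a - b\<bar> \<le> d" "\<bar>a' - b'\<bar> \<le> d" for a a' b b' d :: real
    using that by (auto simp: max_def min_def)
  have "\<bar>dist x q - dist y q\<bar> \<le> dist x y" for q
    using abs_dist_diff_le[of x q y] by (simp add: dist_commute)
  then show ?thesis unfolding even_bump_def by (intro le)
qed

lemma continuous_on_even_bump: "continuous_on S (even_bump p r)"
  unfolding even_bump_def[abs_def] by (intro continuous_intros)

text \<open>All unit vectors over the closed arc, tangent ones included. A bump on pairs of complex
  numbers is also nonzero off the arc, so it is cut off by this set to become a test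
  function.\<close>

definition arc_vectors :: "real^2^2 \<Rightarrow> real \<Rightarrow> (complex \<times> complex) set" where
  "arc_vectors D e = {(geod D u, v) | u v. \<bar>u\<bar> \<le> e \<and> cmod v = Im (geod D u)}"

text \<open>The set is a continuous image of a closed and bounded set of parameters. The closed
  condition \<open>Q\<close> allows two uses: for \<open>arc_vectors\<close> and for the vectors
  that a support must avoid.\<close>

lemma compact_arc_vectors:
  assumes D: "D \<in> SL2R" and Q: "closed {(u, v). Q u v}"
  shows "compact {(geod D u, v) | u v. \<bar>u\<bar> \<le> e \<and> cmod v = Im (geod D u) \<and> Q u v}"
proof -
  define S where "S = {(u, v). \<bar>u\<bar> \<le> e \<and> cmod v = Im (geod D u)} \<inter> {(u, v). Q u v}"
  have cont: "continuous_on T (\<lambda>y. geod D (fst y))" for T :: "(real \<times> complex) set"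
    by (rule continuous_on_compose2[OF continuous_on_geod[OF D, of UNIV]]) (auto intro!: continuous_intros)
  have "{(u, v). \<bar>u\<bar> \<le> e \<and> cmod v = Im (geod D u)} =
      {y. \<bar>fst y\<bar> \<le> e} \<inter> {y. cmod (snd y) = Im (geod D (fst y))}" by auto
  moreover have "closed ({y. \<bar>fst y\<bar> \<le> e} \<inter> {y. cmod (snd y) = Im (geod D (fst y))})"
    by (intro closed_Int closed_Collect_le closed_Collect_eq continuous_intros cont)
  ultimately have "closed S" unfolding S_def using Q by (auto intro: closed_Int)
  moreover have "bounded S"
  proof -
    have "compact ((\<lambda>u. Im (geod D u)) ` {-e..e})"
      by (intro compact_continuous_image continuous_intros continuous_on_geod D) simp
    then obtain M where M: "\<And>u. u \<in> {-e..e} \<Longrightarrow> \<bar>Im (geod D u)\<bar> \<le> M"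
      using compact_imp_bounded[THEN bounded_iff[THEN iffD1]] by (metis image_eqI real_norm_def)
    have "S \<subseteq> {-e..e} \<times> cball 0 M"
      using M by (force simp: S_def abs_le_iff)
    then show ?thesis
      by (rule bounded_subset[OF bounded_Times[OF compact_imp_bounded[OF compact_Icc] bounded_cball]])
  qed
  ultimately have "compact S" by (simp add: compact_eq_bounded_closed)
  moreover have "{(geod D u, v) | u v. \<bar>u\<bar> \<le> e \<and> cmod v = Im (geod D u) \<and> Q u v} = (\<lambda>y. (geod D (fst y), snd y)) ` S"
    by (force simp: S_def)
  ultimately show ?thesis
    by (simp add: compact_continuous_image continuous_on_Pair cont continuous_on_snd continuous_on_id)
qed

lemma test_function_even_bump:
  assumes D: "D \<in> SL2R" and w: "cmod w = Im (geod D 0)" "Im (w * cnj (geod_vel D 0)) \<noteq> 0" and e: "e > 0"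
  obtains R where "R > 0"
    "\<And>r. 0 < r \<Longrightarrow> r < R \<Longrightarrow>
      test_function D (-e) e (\<lambda>x. if x \<in> arc_vectors D e then even_bump (geod D 0, w) r x else 0)"
proof -
  let ?Q = "\<lambda>u v. \<bar>u\<bar> = e \<or> Im (v * cnj (geod_vel D u)) = 0"
  \<comment> \<open>The vectors over the closed arc that are not in \<open>crossing_vectors\<close>:
    those at an end point and those tangent to the arc. The set is closed and misses both signs of
    \<open>w\<close>, hence has positive distance from them.\<close>
  define Bad where "Bad = {(geod D u, v) | u v. \<bar>u\<bar> \<le> e \<and> cmod v = Im (geod D u) \<and> ?Q u v}"
  have cont: "continuous_on T (\<lambda>y. geod_vel D (fst y))" for T :: "(real \<times> complex) set"
    by (rule continuous_on_compose2[OF continuous_on_geod_vel[OF D, of UNIV]]) (auto intro!: continuous_intros)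
  have "{(u, v). ?Q u v} = {y. \<bar>fst y\<bar> = e} \<union> {y. Im (snd y * cnj (geod_vel D (fst y))) = 0}" by auto
  moreover have "closed ({y. \<bar>fst y\<bar> = e} \<union> {y. Im (snd y * cnj (geod_vel D (fst y))) = 0})"
    by (intro closed_Un closed_Collect_eq continuous_intros cont)
  ultimately have "closed {(u, v). ?Q u v}" by simp
  from compact_imp_closed[OF compact_arc_vectors[OF D this]] have "closed Bad" unfolding Bad_def .
  moreover have notbad: "(geod D 0, of_real k * w) \<notin> Bad" if "k \<in> {1, -1}" for k
  proof
    assume "(geod D 0, of_real k * w) \<in> Bad"
    then obtain u where "geod D 0 = geod D u" "?Q u (of_real k * w)" by (auto simp: Bad_def)
    then have "?Q 0 (of_real k * w)" using geod_inj[OF D] by metis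
    then show False using e w(2) that by (auto simp: mult.assoc)
  qed
  ultimately obtain R1 R2 where R: "R1 > 0" "R2 > 0"
     "\<And>x. x \<in> Bad \<Longrightarrow> R1 \<le> dist (geod D 0, w) x" "\<And>x. x \<in> Bad \<Longrightarrow> R2 \<le> dist (geod D 0, - w) x"
    using separate_point_closed[of Bad "(geod D 0, w)"] separate_point_closed[of Bad "(geod D 0, - w)"]
      notbad[of 1] notbad[of "-1"] by auto
  have "test_function D (-e) e (\<lambda>x. if x \<in> arc_vectors D e then even_bump (geod D 0, w) r x else 0)"
    if r: "0 < r" "r < min R1 R2" for r
    unfolding test_function_def
  proof (intro conjI allI exI impI)
    have sub: "crossing_vectors D (-e) e \<subseteq> arc_vectors D e"
      by (fastforce simp: crossing_vectors_def arc_vectors_def abs_le_iff)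
    \<comment> \<open>The cutoff is invisible on this domain, where all vectors lie in
      \<open>arc_vectors D e\<close>.\<close>
    show "continuous_on (crossing_vectors D (-e) e)
        (\<lambda>x. if x \<in> arc_vectors D e then even_bump (geod D 0, w) r x else 0)"
      by (rule continuous_on_eq[OF continuous_on_even_bump[of _ "(geod D 0, w)" r]]) (use sub in auto)
    fix z v
    have "(z, - v) \<in> arc_vectors D e \<longleftrightarrow> (z, v) \<in> arc_vectors D e" by (auto simp: arc_vectors_def)
    then show "(if (z, - v) \<in> arc_vectors D e then even_bump (geod D 0, w) r (z, - v) else 0) =
        (if (z, v) \<in> arc_vectors D e then even_bump (geod D 0, w) r (z, v) else 0)"
      using even_bump_sign[of "-1" "(geod D 0, w)" r z v] by simp
  next
    \<comment> \<open>The non-strict inequality gives a closed set containing the support;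
      \<open>r < min R1 R2\<close> keeps it away from \<open>Bad\<close>.\<close>
    let ?K = "arc_vectors D e \<inter> {x. min (dist x (geod D 0, w)) (dist x (geod D 0, - w)) \<le> r}"
    have "compact (arc_vectors D e)"
      using compact_arc_vectors[OF D, of "\<lambda>_ _. True"] by (simp add: arc_vectors_def)
    moreover have "closed {x. min (dist x (geod D 0, w)) (dist x (geod D 0, - w)) \<le> r}"
      by (intro closed_Collect_le continuous_intros)
    ultimately show "compact ?K" by (rule compact_Int_closed)
    show "?K \<subseteq> crossing_vectors D (-e) e"
    proof
      fix x assume x: "x \<in> ?K"
      then obtain u v where uv: "x = (geod D u, v)" "\<bar>u\<bar> \<le> e" "cmod v = Im (geod D u)"
        by (auto simp: arc_vectors_def)
      have "x \<notin> Bad" using R(3)[of x] R(4)[of x] x r by (auto simp: dist_commute min_le_iff_disj)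
      then have "\<bar>u\<bar> \<noteq> e" "Im (v * cnj (geod_vel D u)) \<noteq> 0" using uv by (auto simp: Bad_def)
      then show "x \<in> crossing_vectors D (-e) e"
        using uv Im_mult_cnj_eq_0[of v "geod_vel D u"] by (auto simp: crossing_vectors_def abs_le_iff intro!: exI[of _ u])
    qed
    fix x assume "x \<notin> ?K"
    then show "(if x \<in> arc_vectors D e then even_bump (geod D 0, w) r x else 0) = 0"
      by (auto simp: even_bump_def)
  qed
  then show ?thesis using that[of "min R1 R2"] R(1,2) by auto
qed

subsection \<open>Convergence\<close>

lemma leaf_vector_exists:
  assumes "surface_group \<Gamma>" "geodesic_lamination \<Gamma> L" "z \<in> hplane" "proj \<Gamma> z \<in> \<Union>L"
  shows "\<exists>v. (z, v) \<in> leaf_vectors \<Gamma> L"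
proof -
  obtain A where A: "A \<in> leaf_frames \<Gamma> L" "geod A 0 = z"
    using leaf_frame_exists[OF assms] by blast
  then have "(z, geod_vel A 0) \<in> leaf_vectors \<Gamma> L"
    unfolding leaf_vectors_eq by (intro image_eqI[of _ _ A]) simp_all
  then show ?thesis ..
qed

section \<open>Positivity of the pairing with the limit lamination\<close>

lemma closed_leaf_parameters:
  assumes L: "geodesic_lamination \<Gamma> L" and D: "D \<in> SL2R"
  shows "closed {t \<in> {0..1}. proj \<Gamma> (geod_arc D a b t) \<in> \<Union>L}"
proof -
  have "continuous_map (top_of_set hplane) (surface \<Gamma>) (proj \<Gamma>)"
    unfolding surface_def by (rule quotient_imp_continuous_map[OF quotient_map_quotient_topology])
  moreover have "continuous_map (top_of_set {0..1}) (top_of_set hplane) (geod_arc D a b)"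
    using continuous_on_geod_arc[OF D] geod_in_hplane[OF D] by (auto simp: geod_arc_def)
  ultimately have "continuous_map (top_of_set {0..1}) (surface \<Gamma>) (proj \<Gamma> \<circ> geod_arc D a b)"
    by (rule continuous_map_compose[rotated])
  moreover have "closedin (surface \<Gamma>) (\<Union>L)"
    using L by (simp add: geodesic_lamination_def)
  ultimately have "closedin (top_of_set {0..1})
      {t \<in> topspace (top_of_set {0..1}). (proj \<Gamma> \<circ> geod_arc D a b) t \<in> \<Union>L}"
    by (rule closedin_continuous_map_preimage)
  then show ?thesis
    using closedin_closed_trans[OF _ closed_atLeastAtMost] by (simp del: Union_iff)
qed

text \<open>The choice \<open>V\<close> may jump between the two signs. The bump does not see the
  sign, and directions are continuous up to sign, so the Lipschitz bound still gives
  continuity.\<close>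

lemma continuous_on_even_bump_leaf_vector:
  fixes T :: "real set"
  assumes \<Gamma>: "surface_group \<Gamma>" and L: "geodesic_lamination \<Gamma> L"
    and c: "continuous_on T c" and V: "\<And>t. t \<in> T \<Longrightarrow> (c t, V t) \<in> leaf_vectors \<Gamma> L"
  shows "continuous_on T (\<lambda>t. even_bump p r (c t, V t))"
  unfolding continuous_on_iff
proof (intro ballI allI impI)
  fix t e assume t: "t \<in> T" and e: "(e::real) > 0"
  obtain A where A: "A \<in> leaf_frames \<Gamma> L" "geod A 0 = c t" "geod_vel A 0 = V t"
    using V[OF t] by (auto simp: leaf_vectors_eq)
  obtain \<epsilon> where \<epsilon>: "\<epsilon> > 0"
    "\<And>B. B \<in> leaf_frames \<Gamma> L \<Longrightarrow> dist (geod B 0) (c t) < \<epsilon> \<Longrightarrow>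
       \<exists>k\<in>{1, -1}. dist (geod_vel B 0) (of_real k * V t) < e / 2"
    using leaf_direction_continuous[OF \<Gamma> L A(1), of "e / 2"] e unfolding A by (metis half_gt_zero)
  have "min \<epsilon> (e / 2) > 0" using \<epsilon> e by simp
  then obtain d where d: "d > 0" "\<And>t'. t' \<in> T \<Longrightarrow> dist t' t < d \<Longrightarrow> dist (c t') (c t) < min \<epsilon> (e / 2)"
    using c t unfolding continuous_on_iff by metis
  have "dist (even_bump p r (c t', V t')) (even_bump p r (c t, V t)) < e" if t': "t' \<in> T" "dist t' t < d" for t'
  proof -
    obtain B where B: "B \<in> leaf_frames \<Gamma> L" "geod B 0 = c t'" "geod_vel B 0 = V t'"
      using V[OF t'(1)] by (auto simp: leaf_vectors_eq)
    have close: "dist (c t') (c t) < \<epsilon>" "dist (c t') (c t) < e / 2" using d(2)[OF t'] by simp_all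
    then obtain k where k: "k \<in> {1, -1}" "dist (V t') (of_real k * V t) < e / 2"
      using \<epsilon>(2)[OF B(1)] unfolding B by blast
    have "dist (even_bump p r (c t', V t')) (even_bump p r (c t, V t)) \<le> dist (c t', V t') (c t, of_real k * V t)"
      using even_bump_Lipschitz[of p r "(c t', V t')" "(c t, of_real k * V t)"]
      unfolding even_bump_sign[OF k(1)] by (simp add: dist_real_def)
    also have "\<dots> \<le> dist (c t') (c t) + dist (V t') (of_real k * V t)"
      unfolding dist_Pair_Pair by (rule sqrt_sum_squares_le_sum) auto
    also have "\<dots> < e" using k(2) close(2) by simp
    finally show ?thesis .
  qed
  then show "\<exists>d>0. \<forall>t'\<in>T. dist t' t < d \<longrightarrow> dist (even_bump p r (c t', V t')) (even_bump p r (c t, V t)) < e"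
    using d(1) by blast
qed

lemma transverse_measureD:
  assumes "transverse_measure \<Gamma> L \<mu>" "transverse_arc \<Gamma> L c"
  shows "sets (\<mu> c) = sets (restrict_space borel {0..1})" "finite_measure (\<mu> c)"
    "emeasure (\<mu> c) {t\<in>{0..1}. proj \<Gamma> (c t) \<notin> \<Union>L} = 0"
    "\<And>t e. t \<in> {0<..<1} \<Longrightarrow> proj \<Gamma> (c t) \<in> \<Union>L \<Longrightarrow> e > 0 \<Longrightarrow>
      emeasure (\<mu> c) ({t-e<..<t+e} \<inter> {0..1}) > 0"
proof -
  note tm = assms(1)[unfolded transverse_measure_def]
  from tm[THEN conjunct2, THEN conjunct1, rule_format, OF assms(2)]
  show "sets (\<mu> c) = sets (restrict_space borel {0..1})" "finite_measure (\<mu> c)" by simp_all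
  from tm[THEN conjunct2, THEN conjunct2, THEN conjunct1, THEN spec, THEN mp, OF assms(2)]
  show "emeasure (\<mu> c) {t\<in>{0..1}. proj \<Gamma> (c t) \<notin> \<Union>L} = 0"
    "\<And>t e. t \<in> {0<..<1} \<Longrightarrow> proj \<Gamma> (c t) \<in> \<Union>L \<Longrightarrow> e > 0 \<Longrightarrow>
      emeasure (\<mu> c) ({t-e<..<t+e} \<inter> {0..1}) > 0"
    by (simp_all del: Union_iff)
qed

lemma pairing_even_bump_pos:
  assumes \<Gamma>: "surface_group \<Gamma>" and lam: "(L, \<mu>) \<in> meas_lams \<Gamma>" and A: "A \<in> leaf_frames \<Gamma> L"
    and D: "D \<in> SL2R" "geod D 0 = geod A 0"
    and e: "e > 0" and trans: "transverse_arc \<Gamma> L (geod_arc D (-e) e)" and r: "r > 0"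
  shows "pairing \<Gamma> D (-e) e
      (\<lambda>x. if x \<in> arc_vectors D e then even_bump (geod A 0, geod_vel A 0) r x else 0) (L, \<mu>) > 0"
proof -
  let ?c = "geod_arc D (-e) e"
  let ?p = "(geod A 0, geod_vel A 0)"
  define M where "M = \<mu> ?c"
  define V where "V t = (SOME v. (?c t, v) \<in> leaf_vectors \<Gamma> L)" for t
  define T where "T = {t \<in> {0..1}. proj \<Gamma> (?c t) \<in> \<Union>L}"
  \<comment> \<open>The indicator of the closed set \<open>T\<close> allows measurability to follow
    from continuity on \<open>T\<close> alone.\<close>
  define g where "g t = indicator T t *\<^sub>R even_bump ?p r (?c t, V t)" for t
  have L: "geodesic_lamination \<Gamma> L" and tm: "transverse_measure \<Gamma> L \<mu>"
    using lam by (auto simp: meas_lams_def)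
  have AS: "A \<in> SL2R" "geod_image \<Gamma> A \<in> L" using A by (auto simp: leaf_frames_def)
  note M = transverse_measureD[OF tm trans, folded M_def]
  note setsM = M(1)
  interpret finite_measure M by (rule M(2))
  have spaceM: "space M = {0..1}"
    using sets_eq_imp_space_eq[OF setsM] by (simp add: space_restrict_space)
  have closedT: "closed T" unfolding T_def by (rule closed_leaf_parameters[OF L D(1)])
  have sets01: "S \<in> sets M" if "S \<in> sets borel" "S \<subseteq> {0..1}" for S
    using that by (simp add: setsM sets_restrict_space_iff)
  have c_hplane: "?c t \<in> hplane" for t using geod_in_hplane[OF D(1)] by (simp add: geod_arc_def)
  have V: "(?c t, V t) \<in> leaf_vectors \<Gamma> L" if "t \<in> T" for t
  proof -
    have "\<exists>v. (?c t, v) \<in> leaf_vectors \<Gamma> L"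
      using that by (intro leaf_vector_exists \<Gamma> L c_hplane) (simp add: T_def)
    then show ?thesis unfolding V_def by (rule someI_ex)
  qed
  have cont: "continuous_on T (\<lambda>t. even_bump ?p r (?c t, V t))"
    by (rule continuous_on_even_bump_leaf_vector[OF \<Gamma> L continuous_on_geod_arc[OF D(1)] V])
  have "g \<in> borel_measurable borel"
    unfolding g_def[abs_def] using closedT by (intro borel_measurable_continuous_on_indicator cont) auto
  then have "g \<in> borel_measurable (restrict_space borel {0..1})" by (rule measurable_restrict_space1)
  then have gM: "g \<in> borel_measurable M" unfolding measurable_cong_sets[OF setsM refl] .
  have bump_range: "0 \<le> even_bump ?p r x" "even_bump ?p r x \<le> r" for x
    using r by (auto simp: even_bump_def min_def)
  have g_int: "integrable M g"
    using bump_range r by (intro integrable_const_bound[of _ r] gM) (auto simp: g_def indicator_def)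
  \<comment> \<open>The arc is centred at the leaf point because full support of the measure is
    available only at interior parameters.\<close>
  have mid: "?c (1/2) = geod A 0" using D(2) by (simp add: geod_arc_def)
  have "proj \<Gamma> (geod A 0) \<in> geod_image \<Gamma> A" by (simp add: geod_image_def)
  then have midT: "1/2 \<in> T" using AS mid by (auto simp: T_def)
  have "even_bump ?p r (?c (1/2), V (1/2)) = r"
  proof -
    obtain B where B: "B \<in> leaf_frames \<Gamma> L" "geod B 0 = geod A 0" "geod_vel B 0 = V (1/2)"
      using V[OF midT] by (auto simp: leaf_vectors_eq mid)
    then obtain k where k: "k \<in> {1, -1}" "V (1/2) = of_real k * geod_vel A 0"
      using leaf_direction_unique[OF \<Gamma> L A] by metis
    show ?thesis unfolding mid k(2) even_bump_sign[OF k(1)] using r by (simp add: even_bump_def)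
  qed
  then obtain d where d: "d > 0"
      "\<And>t. t \<in> T \<Longrightarrow> dist t (1/2) < d \<Longrightarrow> dist (even_bump ?p r (?c t, V t)) r < r / 2"
    using cont midT r unfolding continuous_on_iff by (metis half_gt_zero)
  define W where "W = {1/2-d<..<1/2+d} \<inter> {0..1::real}"
  define S where "S = T \<inter> W"
  have T: "T \<in> sets M" using closedT by (intro sets01) (auto simp: T_def)
  have W: "W \<in> sets M" by (intro sets01) (auto simp: W_def)
  have S: "S \<in> sets M" unfolding S_def using T W by blast
  have "emeasure M W > 0"
    unfolding W_def using midT d(1) by (intro M(4)) (auto simp: T_def)
  \<comment> \<open>\<open>W\<close> has positive measure by full support and the parameters off
    \<open>T\<close> form a null set, so \<open>S\<close> carries mass; there the integrand is at
    least \<open>r / 2\<close>.\<close>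
  also have "emeasure M W \<le> emeasure M (S \<union> (space M - T))"
  proof (rule emeasure_mono)
    show "W \<subseteq> S \<union> (space M - T)" by (auto simp: S_def W_def spaceM)
    show "S \<union> (space M - T) \<in> sets M" using S T by blast
  qed
  also have "\<dots> \<le> emeasure M S + emeasure M (space M - T)"
    using S T by (intro emeasure_subadditive) auto
  also have "space M - T = {t \<in> {0..1}. proj \<Gamma> (?c t) \<notin> \<Union>L}" by (auto simp: spaceM T_def)
  finally have "measure M S > 0" using M(3) by (simp add: emeasure_eq_measure)
  then have "0 < (\<integral>t. r / 2 * indicator S t \<partial>M)"
    using r S sets.sets_into_space[OF S] by (simp add: Int_absorb2)
  also have "\<dots> \<le> (\<integral>t. g t \<partial>M)"
  proof (rule integral_mono[OF _ g_int])
    show "integrable M (\<lambda>t. r / 2 * indicator S t)" using S by (simp add: emeasure_eq_measure)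
    fix t
    show "r / 2 * indicator S t \<le> g t"
    proof (cases "t \<in> S")
      case True
      then have "t \<in> T" "dist t (1/2) < d" by (auto simp: S_def W_def dist_real_def abs_less_iff)
      from d(2)[OF this] have "r / 2 \<le> even_bump ?p r (?c t, V t)" unfolding dist_real_def by linarith
      with \<open>t \<in> T\<close> True show ?thesis by (simp add: g_def)
    next
      case False
      then show ?thesis using bump_range by (simp add: g_def)
    qed
  qed
  \<comment> \<open>The cutoff is inactive along the arc, since leaf vectors over it are unit
    vectors.\<close>
  also have "(\<integral>t. g t \<partial>M) = (\<integral>t. (if proj \<Gamma> (?c t) \<in> \<Union>L
      then (if (?c t, V t) \<in> arc_vectors D e then even_bump ?p r (?c t, V t) else 0) else 0) \<partial>M)"
  proof (rule Bochner_Integration.integral_cong[OF refl])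
    fix t assume "t \<in> space M"
    then have t: "t \<in> {0..1}" by (simp add: spaceM)
    show "g t = (if proj \<Gamma> (?c t) \<in> \<Union>L
      then (if (?c t, V t) \<in> arc_vectors D e then even_bump ?p r (?c t, V t) else 0) else 0)"
    proof (cases "t \<in> T")
      case True
      obtain B where B: "B \<in> SL2R" "geod B 0 = ?c t" "geod_vel B 0 = V t"
        using V[OF True] by (auto simp: leaf_vectors_eq leaf_frames_def)
      have "0 \<le> e * t" "e * t \<le> e" using t e by (simp_all add: mult_left_le)
      then have "\<bar>-e + (e - -e) * t\<bar> \<le> e" by (simp add: abs_le_iff algebra_simps)
      moreover have "cmod (V t) = Im (?c t)" using cmod_geod_vel[OF B(1), of 0] B by simp
      ultimately have "(?c t, V t) \<in> arc_vectors D e"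
        unfolding arc_vectors_def geod_arc_def by blast
      with True show ?thesis by (simp add: g_def T_def del: Union_iff)
    next
      case False
      with t have "proj \<Gamma> (?c t) \<notin> \<Union>L" by (auto simp: T_def)
      then show ?thesis using False by (simp add: g_def del: Union_iff)
    qed
  qed
  finally show ?thesis unfolding pairing_def Let_def prod.case if_P[OF trans] V_def M_def .
qed

text \<open>A nonzero value excludes both the default 0 for arcs that are not transverse and an
  integrand that vanishes identically. No estimate of the measure enters.\<close>

lemma leaf_vector_in_support:
  assumes \<Gamma>: "surface_group \<Gamma>" and L: "geodesic_lamination \<Gamma> L" and D: "D \<in> SL2R"
    and ne: "pairing \<Gamma> D a b f (L, \<mu>) \<noteq> 0"
  obtains y where "y \<in> leaf_vectors \<Gamma> L" "f y \<noteq> 0"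
proof -
  let ?c = "geod_arc D a b"
  let ?g = "\<lambda>t. if proj \<Gamma> (?c t) \<in> \<Union>L then f (?c t, SOME v. (?c t, v) \<in> leaf_vectors \<Gamma> L) else 0"
  have "\<exists>t. ?g t \<noteq> 0"
  proof (rule ccontr)
    assume "\<nexists>t. ?g t \<noteq> 0"
    then have "?g = (\<lambda>t. 0)" by blast
    then have "(\<integral>t. ?g t \<partial>(\<mu> ?c)) = 0" by (simp only: Bochner_Integration.integral_zero)
    with ne show False by (simp add: pairing_def Let_def del: Union_iff split: if_splits)
  qed
  then obtain t where t: "proj \<Gamma> (?c t) \<in> \<Union>L" "f (?c t, SOME v. (?c t, v) \<in> leaf_vectors \<Gamma> L) \<noteq> 0"
    by (metis (no_types, lifting))
  have "?c t \<in> hplane" using geod_in_hplane[OF D] by (simp add: geod_arc_def)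
  then have "\<exists>v. (?c t, v) \<in> leaf_vectors \<Gamma> L"
    by (intro leaf_vector_exists \<Gamma> L t(1))
  then have "(?c t, SOME v. (?c t, v) \<in> leaf_vectors \<Gamma> L) \<in> leaf_vectors \<Gamma> L" by (rule someI_ex)
  with that t(2) show ?thesis by blast
qed

lemma eventually_near_leaf_vectors:
  assumes \<Gamma>: "surface_group \<Gamma>" and lam: "\<And>i. lam i \<in> meas_lams \<Gamma>" and lam': "lam' \<in> meas_lams \<Gamma>"
    and lim: "limitin (weak_star_topology \<Gamma>) lam lam' sequentially"
    and A: "A \<in> leaf_frames \<Gamma> (fst lam')" and "\<epsilon> > 0"
  shows "\<forall>\<^sub>F i in sequentially. \<exists>y\<in>leaf_vectors \<Gamma> (fst (lam i)). \<exists>k\<in>{1, -1}.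
    dist (fst y, of_real k * snd y) (geod A 0, geod_vel A 0) < \<epsilon>"
proof -
  let ?w = "geod_vel A 0"
  obtain L \<mu> where L\<mu>: "lam' = (L, \<mu>)" by fastforce
  have L: "geodesic_lamination \<Gamma> L" and AL: "A \<in> leaf_frames \<Gamma> L"
    using lam' A by (auto simp: L\<mu> meas_lams_def)
  have AS: "A \<in> SL2R" using A by (simp add: leaf_frames_def)
  obtain D where D: "D \<in> SL2R" "geod D 0 = geod A 0" "geod_vel D 0 = \<i> * ?w"
    using perpendicular_geod[OF AS] by blast
  obtain e where e: "e > 0" "transverse_arc \<Gamma> L (geod_arc D (-e) e)"
    using transverse_arc_exists[OF \<Gamma> L AL D] by blast
  have w: "cmod ?w = Im (geod D 0)" using cmod_geod_vel[OF AS] D(2) by simp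
  have "Im (?w * cnj (\<i> * ?w)) = - (cmod ?w)\<^sup>2" unfolding cmod_power2 by (simp add: power2_eq_square)
  then have "Im (?w * cnj (geod_vel D 0)) \<noteq> 0"
    unfolding D(3) using geod_vel_nonzero[OF AS, of 0]
    by (simp only: neg_equal_0_iff_equal norm_eq_zero zero_eq_power2 not_False_eq_True)
  from test_function_even_bump[OF D(1) w this e(1)]
  obtain R where R: "R > 0" "\<And>r. 0 < r \<Longrightarrow> r < R \<Longrightarrow>
      test_function D (-e) e (\<lambda>x. if x \<in> arc_vectors D e then even_bump (geod A 0, ?w) r x else 0)"
    unfolding D(2) by blast
  \<comment> \<open>Below \<open>R\<close> to obtain a test function, at most
    \<open>\<epsilon>\<close> to keep its support close to the two signs of the given
    vector.\<close>
  define r where "r = min (R / 2) \<epsilon>"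
  have r: "0 < r" "r < R" "r \<le> \<epsilon>" using R(1) \<open>\<epsilon> > 0\<close> by (auto simp: r_def)
  define f where "f = (\<lambda>x. if x \<in> arc_vectors D e then even_bump (geod A 0, ?w) r x else 0)"
  \<comment> \<open>A subbasic open set of the weak* topology, as positivity is an open condition on
    the pairing.\<close>
  let ?U = "{m \<in> meas_lams \<Gamma>. pairing \<Gamma> D (-e) e f m \<in> {0<..}}"
  have "-e < e" using e(1) by simp
  moreover have "test_function D (-e) e f" unfolding f_def using R(2) r by blast
  moreover have "open ({0<..} :: real set)" by simp
  ultimately have "openin (weak_star_topology \<Gamma>) ?U"
    unfolding weak_star_topology_def using D(1)
    by (intro topology_generated_by_Basis) blast
  moreover have "lam' \<in> ?U"
    using pairing_even_bump_pos[OF \<Gamma> _ AL D(1,2) e r(1)] lam' unfolding f_def L\<mu> by simp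
  ultimately have "\<forall>\<^sub>F i in sequentially. lam i \<in> ?U"
    using lim unfolding limitin_def by blast
  then show ?thesis
  proof (rule eventually_mono)
    fix i assume "lam i \<in> ?U"
    then have ne: "pairing \<Gamma> D (-e) e f (fst (lam i), snd (lam i)) \<noteq> 0" by simp
    have "geodesic_lamination \<Gamma> (fst (lam i))" using lam[of i] by (auto simp: meas_lams_def)
    from leaf_vector_in_support[OF \<Gamma> this D(1) ne] obtain y
      where y: "y \<in> leaf_vectors \<Gamma> (fst (lam i))" "f y \<noteq> 0" by blast
    from y(2) have "dist y (geod A 0, ?w) < r \<or> dist y (geod A 0, - ?w) < r"
      by (auto simp: f_def even_bump_def min_def split: if_splits)
    \<comment> \<open>Negation is an isometry, so the sign can be put on \<open>y\<close> instead of
      the target vector.\<close>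
    moreover have "dist y (geod A 0, - ?w) = dist (fst y, - snd y) (geod A 0, ?w)"
      using dist_minus[of "snd y" "- ?w"] by (cases y) (simp add: dist_Pair_Pair)
    ultimately have "\<exists>k\<in>{1, -1}. dist (fst y, of_real k * snd y) (geod A 0, ?w) < \<epsilon>"
      using r(3) by auto
    with y(1) show "\<exists>y\<in>leaf_vectors \<Gamma> (fst (lam i)). \<exists>k\<in>{1, -1}.
        dist (fst y, of_real k * snd y) (geod A 0, ?w) < \<epsilon>" by blast
  qed
qed

text \<open>The infimal distance need not be attained, so \<open>y i\<close> is chosen within
  \<open>inverse (real (Suc i))\<close> of it; one choice then serves every
  \<open>\<epsilon>\<close>. Where \<open>Y i\<close> is empty, \<open>y i\<close> is arbitrary,
  which affects only finitely many indices.\<close>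

lemma sequence_tendsto_if_eventually_near:
  fixes x :: "'a::metric_space"
  assumes "\<And>\<epsilon>. \<epsilon> > 0 \<Longrightarrow> \<forall>\<^sub>F i in sequentially. \<exists>y\<in>Y i. dist y x < \<epsilon>"
  obtains y where "\<forall>\<^sub>F i in sequentially. y i \<in> Y i" "y \<longlonglongrightarrow> x"
proof -
  have "\<exists>y. Y i \<noteq> {} \<longrightarrow> y \<in> Y i \<and> dist y x < infdist x (Y i) + inverse (real (Suc i))" for i
  proof (cases "Y i = {}")
    case False
    then obtain y where "y \<in> Y i" "dist x y < infdist x (Y i) + inverse (real (Suc i))"
      using cInf_lessD[of "dist x ` Y i" "infdist x (Y i) + inverse (real (Suc i))"]
      by (auto simp: infdist_notempty)
    then show ?thesis by (auto simp: dist_commute)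
  qed simp
  then obtain y where y: "\<And>i. Y i \<noteq> {} \<Longrightarrow> y i \<in> Y i \<and> dist (y i) x < infdist x (Y i) + inverse (real (Suc i))"
    by metis
  have "\<forall>\<^sub>F i in sequentially. Y i \<noteq> {}"
    using assms[of 1] by (auto elim: eventually_mono)
  then have "\<forall>\<^sub>F i in sequentially. y i \<in> Y i" by (rule eventually_mono) (use y in blast)
  moreover have "y \<longlonglongrightarrow> x"
  proof (rule tendstoI)
    fix \<epsilon> :: real assume "\<epsilon> > 0"
    then have "\<forall>\<^sub>F i in sequentially. inverse (real (Suc i)) < \<epsilon> / 2"
      by (intro order_tendstoD(2)[OF LIMSEQ_inverse_real_of_nat]) simp
    moreover have "\<forall>\<^sub>F i in sequentially. \<exists>y\<in>Y i. dist y x < \<epsilon> / 2"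
      using assms[of "\<epsilon> / 2"] \<open>\<epsilon> > 0\<close> by (simp only: half_gt_zero)
    ultimately show "\<forall>\<^sub>F i in sequentially. dist (y i) x < \<epsilon>"
    proof eventually_elim
      case (elim i)
      then obtain u where u: "u \<in> Y i" "dist u x < \<epsilon> / 2" by blast
      have "infdist x (Y i) < \<epsilon> / 2" using infdist_le[OF u(1), of x] u(2) by (simp add: dist_commute)
      with y[of i] u(1) elim(1) show ?case by fastforce
    qed
  qed
  ultimately show ?thesis using that by blast
qed

lemma tangent_line_sign:
  assumes "k \<in> {1, -1}"
  shows "tangent_line \<Gamma> (z, of_real k * v) = tangent_line \<Gamma> (z, v)"
proof -
  have "tangent_line \<Gamma> (z, - v) \<subseteq> tangent_line \<Gamma> (z, v)" for v
  proof
    fix y assume "y \<in> tangent_line \<Gamma> (z, - v)"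
    then obtain A s where A: "A \<in> \<Gamma>" "s \<in> {1, -1}" "y = (mact A z, s * (deriv (mact A) z * - v))"
      by (auto simp: tangent_line_def)
    then have "y = (mact A z, (- s) * (deriv (mact A) z * v))" "- s \<in> {1, -1}" by auto
    with A(1) show "y \<in> tangent_line \<Gamma> (z, v)" unfolding tangent_line_def by blast
  qed
  from this[of v] this[of "- v"] have "tangent_line \<Gamma> (z, - v) = tangent_line \<Gamma> (z, v)"
    unfolding minus_minus by (rule equalityI)
  moreover from assms have "of_real k * v = v \<or> of_real k * v = - v" by auto
  ultimately show ?thesis by metis
qed

theorem proposition0p4:
  fixes \<Gamma> :: "(real^2^2) set" and g p :: nat
    and lam :: "nat \<Rightarrow> lamination \<times> transverse_family"
    and lam' :: "lamination \<times> transverse_family"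
  assumes "hyperbolic_surface \<Gamma> g p"
    and "3 * g + p \<ge> 5"
    and "\<And>i. lam i \<in> meas_lams \<Gamma>"
    and "lam' \<in> meas_lams \<Gamma>"
    and "limitin (weak_star_topology \<Gamma>) lam lam' sequentially"
  shows "super_converges (PT \<Gamma>) (\<lambda>i. PT_lift \<Gamma> (forget (lam i))) (PT_lift \<Gamma> (forget lam'))"
  unfolding super_converges_def
proof
  have \<Gamma>: "surface_group \<Gamma>" using assms(1) by (simp add: hyperbolic_surface_def)
  fix x assume "x \<in> PT_lift \<Gamma> (forget lam')"
  then obtain A where A: "A \<in> leaf_frames \<Gamma> (fst lam')" and x: "x = tangent_line \<Gamma> (geod A 0, geod_vel A 0)"
    by (auto simp: PT_lift_def forget_def leaf_vectors_eq)
  let ?Y = "\<lambda>i. {(z, of_real k * v) | z v k. (z, v) \<in> leaf_vectors \<Gamma> (fst (lam i)) \<and> k \<in> {1, -1}}"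
  have unit: "(geod B 0, of_real k * geod_vel B 0) \<in> unit_tangents" if "B \<in> leaf_frames \<Gamma> L" "k \<in> {1, -1}" for B k L
    using that geod_in_hplane[of B 0] cmod_geod_vel[of B 0]
    by (auto simp: unit_tangents_def leaf_frames_def norm_mult)
  have "\<forall>\<^sub>F i in sequentially. \<exists>y\<in>?Y i. dist y (geod A 0, geod_vel A 0) < \<epsilon>" if "\<epsilon> > 0" for \<epsilon>
    using eventually_near_leaf_vectors[OF \<Gamma> assms(3-5) A that]
  proof (rule eventually_mono)
    fix i assume "\<exists>y\<in>leaf_vectors \<Gamma> (fst (lam i)). \<exists>k\<in>{1, -1}.
        dist (fst y, of_real k * snd y) (geod A 0, geod_vel A 0) < \<epsilon>"
    then obtain z v k where "(z, v) \<in> leaf_vectors \<Gamma> (fst (lam i))" "k \<in> {1, -1}"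
        "dist (z, of_real k * v) (geod A 0, geod_vel A 0) < \<epsilon>" by (metis prod.collapse)
    then show "\<exists>y\<in>?Y i. dist y (geod A 0, geod_vel A 0) < \<epsilon>" by blast
  qed
  then obtain y where y: "\<forall>\<^sub>F i in sequentially. y i \<in> ?Y i" "y \<longlonglongrightarrow> (geod A 0, geod_vel A 0)"
    using sequence_tendsto_if_eventually_near[of ?Y] by blast
  have in_lift: "tangent_line \<Gamma> y \<in> PT_lift \<Gamma> (fst (lam i))" if "y \<in> ?Y i" for y i
    using that tangent_line_sign unfolding PT_lift_def by fastforce
  have Y_unit: "?Y i \<subseteq> unit_tangents" for i
    using unit by (auto simp: leaf_vectors_eq)
  have "\<forall>\<^sub>F i in sequentially. y i \<in> unit_tangents"
    using y(1) by (rule eventually_mono) (use Y_unit in blast)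
  \<comment> \<open>Convergence is established among unit vectors and then pushed forward by the
    continuous quotient map.\<close>
  then have "limitin (top_of_set unit_tangents) y (geod A 0, geod_vel A 0) sequentially"
    unfolding limitin_subtopology limitin_canonical_iff
    using y(2) unit[OF A, of 1] by simp
  moreover have "continuous_map (top_of_set unit_tangents) (PT \<Gamma>) (tangent_line \<Gamma>)"
    unfolding PT_def by (rule quotient_imp_continuous_map[OF quotient_map_quotient_topology])
  ultimately have "limitin (PT \<Gamma>) (tangent_line \<Gamma> \<circ> y) x sequentially"
    unfolding x by (intro continuous_map_limit)
  moreover have "\<forall>\<^sub>F i in sequentially. (tangent_line \<Gamma> \<circ> y) i \<in> PT_lift \<Gamma> (forget (lam i))"
    using y(1) by (rule eventually_mono) (use in_lift in \<open>auto simp: forget_def\<close>)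
  ultimately show "\<exists>xs. (\<forall>\<^sub>F i in sequentially. xs i \<in> PT_lift \<Gamma> (forget (lam i))) \<and>
      limitin (PT \<Gamma>) xs x sequentially" by blast
qed

end
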